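(* Consider the symmetric diamond network with orthogonal broadcast links ($C_1=C_2=C\ge0$) and the binary adder MAC. Let $p^{(1)}=\frac{1}{1+\sqrt2}$. If $C\le 0.75$ or $C\ge 1-\frac{p^{(1)}}{2}$, then $$C^\diamond=\max_{0\le p\le\frac12}\min\Big\{2C,\ C+h_2(p),\ h_2(p)+1-p,\ C+h_2(p)-\tfrac p2\Big\}=\max_{0\le p\le\frac12}\min\Big\{2C-1+h_2(p),\ C+h_2(p),\ h_2(p)+1-p\Big\},$$ i.e. the upper bound of Corollary 2 (derived from Theorem 2) meets the lower bound of Theorem 1.
   Context: Diamond network with orthogonal broadcast component: a message $W$ uniform on $\{1,\dots,2^{nR}\}$ is encoded into $(V_1^n,V_2^n)$ with $H(V_1^n)\le nC_1$, $H(V_2^n)\le nC_2$; $V_i^n$ is delivered without error to relay $i$, which maps it to $X_i^n\in\{0,1\}^n$. The binary adder MAC outputs $Y_l=X_{1,l}+X_{2,l}\in\{0,1,2\}$. A decoder forms $\hat W$ from $Y^n$; $R$ is achievable if $\Pr(\hat W\ne W)$ can be made arbitrarily small for some $n$; $C^\diamond$ is the supremum of achievable rates. $h_2(q)=-q\log_2 q-(1-q)\log_2(1-q)$ is the binary entropy function. *)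

theory Defs
  imports Complex_Main
begin

text \<open>Binary entropy function (with 0 log 0 = 0, automatic since 0 * _ = 0).\<close>
definition h2 :: "real \<Rightarrow> real" where
  "h2 q = - q * log 2 q - (1 - q) * log 2 (1 - q)"

definition entropy_unif :: "nat set \<Rightarrow> (nat \<Rightarrow> 'b) \<Rightarrow> real" where
  "entropy_unif M f =
     (\<Sum>v\<in>f ` M. let q = real (card {w\<in>M. f w = v}) / real (card M) in - q * log 2 q)"

definition adder_out :: "bool list \<Rightarrow> bool list \<Rightarrow> nat list" where
  "adder_out xs ys = map2 (\<lambda>a b. of_bool a + of_bool b) xs ys"

definition num_msgs :: "nat \<Rightarrow> real \<Rightarrow> nat" where
  "num_msgs n R = nat \<lceil>2 powr (real n * R)\<rceil>"

text \<open>A code of blocklength n and rate R: encoders f1,f2 (message to V_i^n, coded into nat),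
  relays g1,g2 (V_i^n to X_i^n in {0,1}^n), decoder d (Y^n to message estimate).
  Its error probability for W uniform on {1..N}:\<close>
definition code_error ::
  "nat \<Rightarrow> real \<Rightarrow> (nat \<Rightarrow> nat) \<Rightarrow> (nat \<Rightarrow> nat) \<Rightarrow> (nat \<Rightarrow> bool list) \<Rightarrow> (nat \<Rightarrow> bool list)
    \<Rightarrow> (nat list \<Rightarrow> nat) \<Rightarrow> real" where
  "code_error n R f1 f2 g1 g2 d =
     real (card {w\<in>{1..num_msgs n R}. d (adder_out (g1 (f1 w)) (g2 (f2 w))) \<noteq> w})
       / real (num_msgs n R)"

definition diamond_achievable :: "real \<Rightarrow> real \<Rightarrow> real \<Rightarrow> bool" where
  "diamond_achievable C1 C2 R \<longleftrightarrow> R \<ge> 0 \<and>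
     (\<forall>\<epsilon>>0. \<exists>n>0. \<exists>(f1::nat\<Rightarrow>nat) (f2::nat\<Rightarrow>nat) (g1::nat\<Rightarrow>bool list) (g2::nat\<Rightarrow>bool list)
         (d::nat list\<Rightarrow>nat).
        entropy_unif {1..num_msgs n R} f1 \<le> real n * C1 \<and>
        entropy_unif {1..num_msgs n R} f2 \<le> real n * C2 \<and>
        (\<forall>v. length (g1 v) = n) \<and> (\<forall>v. length (g2 v) = n) \<and>
        code_error n R f1 f2 g1 g2 d \<le> \<epsilon>)"

definition diamond_capacity :: "real \<Rightarrow> real \<Rightarrow> real" where
  "diamond_capacity C1 C2 = Sup {R. diamond_achievable C1 C2 R}"

definition p1 :: real where
  "p1 = 1 / (1 + sqrt 2)"

end

theory Submission
  imports Defs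
begin

text \<open>
  Converse. For \<open>C \<le> 3/4\<close> the value is \<open>2C \<ge> H(V\<^sub>1) + H(V\<^sub>2)\<close> per letter. Otherwise let \<open>p\<close> be the
  maximiser. Pass each output letter through a memoryless channel to a
  bit \<open>U\<close> chosen so that, for a doubly symmetric binary pair with crossover probability \<open>p\<close>,
  the chain \<open>X\<^sub>1 - U - X\<^sub>2\<close> is Markov. From
  \<open>I(V\<^sub>1; V\<^sub>2) \<ge> H(U) - H(U | V\<^sub>1) - H(U | V\<^sub>2) + H(U | V\<^sub>1, V\<^sub>2)\<close> and
  \<open>H(Y) - H(U) = H(Y | U) - H(U | Y)\<close> one gets an upper bound on \<open>H(V\<^sub>1, V\<^sub>2) + H(Y)\<close> in which only
  conditional entropies appear with a positive sign. Bounding those by cross entropies against the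
  symmetric product laws, the auxiliary \<open>U\<close> cancels letter by letter and leaves a cost that is
  affine in the expected fraction of letters with \<open>X\<^sub>1 \<noteq> X\<^sub>2\<close>: it is the tangent at \<open>p\<close> of
  \<open>2 h\<^sub>2(p) - p\<close>. Together with the tangent of \<open>h\<^sub>2(p) + 1 - p\<close> from \<open>H(Y)\<close> alone,
  the conditions \<open>1/3 \<le> p \<le> p\<^sup>(\<^sup>1\<^sup>)\<close> on the signs of the slopes give the bound.

  Achievability. A code without errors exists at rate \<open>R\<close> as soon as sets \<open>A, B\<close> of binary words
  of length \<open>n\<close> with at most \<open>2\<^sup>n\<^sup>C\<close> elements have at least \<open>2\<^sup>n\<^sup>R\<close> distinct sums: the encoder
  picks a pair representing the sum that names the message. Taking all words for one relay, and for
  the other a small set with many different traces on most coordinate sets of size \<open>(1 - p) n\<close>, and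
  swapping the relays halfway, reaches \<open>h\<^sub>2(p) + min (1 - p) (2C - 1)\<close>.
\<close>

section \<open>Entropy of functions on a finite weighted set\<close>

definition marg :: "'a set \<Rightarrow> ('a \<Rightarrow> real) \<Rightarrow> ('a \<Rightarrow> 'b) \<Rightarrow> 'b \<Rightarrow> real" where
  "marg \<Omega> m f v = (\<Sum>\<omega>\<in>{\<omega>\<in>\<Omega>. f \<omega> = v}. m \<omega>)"

text \<open>Written as a mean of minus log-probabilities over the sample space rather than a sum
  over values, so that entropies of functions with different ranges combine pointwise under one
  sum.\<close>

definition ent :: "'a set \<Rightarrow> ('a \<Rightarrow> real) \<Rightarrow> ('a \<Rightarrow> 'b) \<Rightarrow> real" where
  "ent \<Omega> m f = (\<Sum>\<omega>\<in>\<Omega>. m \<omega> * - log 2 (marg \<Omega> m f (f \<omega>)))"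

lemma ent_eq_if_same_kernel:
  assumes "\<And>\<omega> \<omega>'. \<omega> \<in> \<Omega> \<Longrightarrow> \<omega>' \<in> \<Omega> \<Longrightarrow> f \<omega> = f \<omega>' \<longleftrightarrow> g \<omega> = g \<omega>'"
  shows "ent \<Omega> m f = ent \<Omega> m g"
  unfolding ent_def
proof (intro sum.cong refl)
  fix \<omega> assume "\<omega> \<in> \<Omega>"
  then have "{\<omega>'\<in>\<Omega>. f \<omega>' = f \<omega>} = {\<omega>'\<in>\<Omega>. g \<omega>' = g \<omega>}" using assms by blast
  then show "m \<omega> * - log 2 (marg \<Omega> m f (f \<omega>)) = m \<omega> * - log 2 (marg \<Omega> m g (g \<omega>))"
    by (simp add: marg_def)
qed

text \<open>Strictly positive weights make every marginal positive at attained values, so no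
  logarithm of zero occurs.\<close>

locale finite_weights =
  fixes \<Omega> :: "'a set" and m :: "'a \<Rightarrow> real"
  assumes fin: "finite \<Omega>" and pos: "\<And>\<omega>. \<omega> \<in> \<Omega> \<Longrightarrow> 0 < m \<omega>" and total: "sum m \<Omega> = 1"
begin

lemma marg_nonneg: "0 \<le> marg \<Omega> m f v"
  unfolding marg_def by (intro sum_nonneg) (use pos in \<open>auto intro: less_imp_le\<close>)

lemma marg_pos: "\<omega> \<in> \<Omega> \<Longrightarrow> 0 < marg \<Omega> m f (f \<omega>)"
  unfolding marg_def by (intro sum_pos) (use fin pos in auto)

lemma sum_marg_image: "(\<Sum>v\<in>f ` \<Omega>. marg \<Omega> m f v) = 1"
  unfolding marg_def using sum.image_gen[OF fin, of m f] total by simp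

lemma sum_marg_pair: "(\<Sum>a\<in>f ` \<Omega>. marg \<Omega> m (\<lambda>\<omega>. (f \<omega>, g \<omega>)) (a, c)) = marg \<Omega> m g c"
proof -
  have "{\<omega>\<in>\<Omega>. (f \<omega>, g \<omega>) = (a, c)} = {\<omega>\<in>{\<omega>\<in>\<Omega>. g \<omega> = c}. f \<omega> = a}" for a
    by auto
  then show ?thesis
    unfolding marg_def using sum.group[of "{\<omega>\<in>\<Omega>. g \<omega> = c}" "f ` \<Omega>" f m] fin by (simp add: image_mono)
qed

text \<open>Gibbs' inequality, from \<open>ln t \<le> t - 1\<close> at the ratio of \<open>G\<close>
  to the true marginal. \<open>G\<close> may be a sub-probability on the image.\<close>

lemma ent_le_cross_entropy:
  assumes G: "\<And>\<omega>. \<omega> \<in> \<Omega> \<Longrightarrow> 0 < G (f \<omega>)" and G1: "(\<Sum>v\<in>f ` \<Omega>. G v) \<le> 1"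
  shows "ent \<Omega> m f \<le> (\<Sum>\<omega>\<in>\<Omega>. m \<omega> * - log 2 (G (f \<omega>)))"
proof -
  let ?P = "marg \<Omega> m f"
  have P: "0 < ?P (f \<omega>)" if "\<omega> \<in> \<Omega>" for \<omega> using marg_pos[OF that] .
  have "(\<Sum>\<omega>\<in>\<Omega>. m \<omega> * (G (f \<omega>) / ?P (f \<omega>)))
      = (\<Sum>v\<in>f ` \<Omega>. \<Sum>\<omega>\<in>{\<omega>\<in>\<Omega>. f \<omega> = v}. m \<omega> * (G (f \<omega>) / ?P (f \<omega>)))"
    by (rule sum.image_gen[OF fin])
  also have "\<dots> = (\<Sum>v\<in>f ` \<Omega>. ?P v * (G v / ?P v))"
  proof (intro sum.cong refl)
    fix v
    have "(\<Sum>\<omega>\<in>{\<omega>\<in>\<Omega>. f \<omega> = v}. m \<omega> * (G (f \<omega>) / ?P (f \<omega>)))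
        = (\<Sum>\<omega>\<in>{\<omega>\<in>\<Omega>. f \<omega> = v}. m \<omega> * (G v / ?P v))" by (intro sum.cong) auto
    then show "(\<Sum>\<omega>\<in>{\<omega>\<in>\<Omega>. f \<omega> = v}. m \<omega> * (G (f \<omega>) / ?P (f \<omega>))) = ?P v * (G v / ?P v)"
      by (simp only: marg_def sum_distrib_right)
  qed
  also have "\<dots> = (\<Sum>v\<in>f ` \<Omega>. G v)"
  proof (intro sum.cong refl)
    fix v assume "v \<in> f ` \<Omega>"
    then have "?P v \<noteq> 0" using P by fastforce
    then show "?P v * (G v / ?P v) = G v" by simp
  qed
  finally have ratio: "(\<Sum>\<omega>\<in>\<Omega>. m \<omega> * (G (f \<omega>) / ?P (f \<omega>))) \<le> 1" using G1 by simp
  have "(\<Sum>\<omega>\<in>\<Omega>. m \<omega> * (log 2 (G (f \<omega>)) - log 2 (?P (f \<omega>))))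
      \<le> (\<Sum>\<omega>\<in>\<Omega>. m \<omega> * ((G (f \<omega>) / ?P (f \<omega>) - 1) / ln 2))"
  proof (intro sum_mono mult_left_mono)
    fix \<omega> assume w: "\<omega> \<in> \<Omega>"
    have "ln (G (f \<omega>) / ?P (f \<omega>)) \<le> G (f \<omega>) / ?P (f \<omega>) - 1"
      by (rule ln_le_minus_one) (use G P w in simp)
    then show "log 2 (G (f \<omega>)) - log 2 (?P (f \<omega>)) \<le> (G (f \<omega>) / ?P (f \<omega>) - 1) / ln 2"
      using G[OF w] P[OF w] by (simp add: log_def ln_div diff_divide_distrib[symmetric] divide_right_mono)
    show "0 \<le> m \<omega>" using pos[OF w] by simp
  qed
  also have "\<dots> = ((\<Sum>\<omega>\<in>\<Omega>. m \<omega> * (G (f \<omega>) / ?P (f \<omega>))) - 1) / ln 2"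
    using total by (simp add: sum_divide_distrib[symmetric] right_diff_distrib sum_subtractf)
  also have "\<dots> \<le> 0" using ratio by (simp add: divide_le_0_iff)
  finally show ?thesis
    by (simp add: ent_def sum_subtractf right_diff_distrib sum_negf)
qed

text \<open>Cross entropy against the marginal of \<open>f\<close> times the kernel
  \<open>Q\<close>. Nonnegativity is asked for all combinations of values because the image of the
  pair is enlarged to a product.\<close>

lemma ent_chain_le:
  assumes Q: "\<And>\<omega>. \<omega> \<in> \<Omega> \<Longrightarrow> 0 < Q (f \<omega>) (g \<omega>)"
    and Q0: "\<And>\<omega> \<omega>'. \<omega> \<in> \<Omega> \<Longrightarrow> \<omega>' \<in> \<Omega> \<Longrightarrow> 0 \<le> Q (f \<omega>) (g \<omega>')"
    and Q1: "\<And>\<omega>. \<omega> \<in> \<Omega> \<Longrightarrow> (\<Sum>v\<in>g ` \<Omega>. Q (f \<omega>) v) \<le> 1"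
  shows "ent \<Omega> m (\<lambda>\<omega>. (f \<omega>, g \<omega>)) \<le> ent \<Omega> m f + (\<Sum>\<omega>\<in>\<Omega>. m \<omega> * - log 2 (Q (f \<omega>) (g \<omega>)))"
proof -
  define G where "G = (\<lambda>(a, b). marg \<Omega> m f a * Q a b)"
  have "ent \<Omega> m (\<lambda>\<omega>. (f \<omega>, g \<omega>)) \<le> (\<Sum>\<omega>\<in>\<Omega>. m \<omega> * - log 2 (G (f \<omega>, g \<omega>)))"
  proof (rule ent_le_cross_entropy)
    show "0 < G (f \<omega>, g \<omega>)" if "\<omega> \<in> \<Omega>" for \<omega>
      using Q[OF that] marg_pos[OF that, of f] by (simp add: G_def)
    have "(\<Sum>v\<in>(\<lambda>\<omega>. (f \<omega>, g \<omega>)) ` \<Omega>. G v) \<le> (\<Sum>v\<in>f ` \<Omega> \<times> g ` \<Omega>. G v)"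
      by (rule sum_mono2) (use fin Q0 in \<open>auto simp: G_def intro!: mult_nonneg_nonneg marg_nonneg\<close>)
    also have "\<dots> = (\<Sum>a\<in>f ` \<Omega>. marg \<Omega> m f a * (\<Sum>b\<in>g ` \<Omega>. Q a b))"
      by (simp add: G_def sum.cartesian_product[symmetric] sum_distrib_left)
    also have "\<dots> \<le> (\<Sum>a\<in>f ` \<Omega>. marg \<Omega> m f a * 1)"
      by (intro sum_mono mult_left_mono) (use Q1 in \<open>auto intro: marg_nonneg\<close>)
    finally show "(\<Sum>v\<in>(\<lambda>\<omega>. (f \<omega>, g \<omega>)) ` \<Omega>. G v) \<le> 1" by (simp add: sum_marg_image)
  qed
  also have "\<dots> = (\<Sum>\<omega>\<in>\<Omega>. m \<omega> * - log 2 (marg \<Omega> m f (f \<omega>)) + m \<omega> * - log 2 (Q (f \<omega>) (g \<omega>)))"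
  proof (intro sum.cong refl)
    fix \<omega> assume w: "\<omega> \<in> \<Omega>"
    show "m \<omega> * - log 2 (G (f \<omega>, g \<omega>))
        = m \<omega> * - log 2 (marg \<Omega> m f (f \<omega>)) + m \<omega> * - log 2 (Q (f \<omega>) (g \<omega>))"
      using Q[OF w] marg_pos[OF w, of f] by (simp add: G_def log_mult algebra_simps)
  qed
  finally show ?thesis by (simp only: ent_def[of _ _ f] sum.distrib)
qed

lemma ent_subadditive: "ent \<Omega> m (\<lambda>\<omega>. (f \<omega>, g \<omega>)) \<le> ent \<Omega> m f + ent \<Omega> m g"
proof -
  have "ent \<Omega> m (\<lambda>\<omega>. (f \<omega>, g \<omega>))
      \<le> ent \<Omega> m f + (\<Sum>\<omega>\<in>\<Omega>. m \<omega> * - log 2 (marg \<Omega> m g (g \<omega>)))"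
    by (rule ent_chain_le) (auto intro: marg_pos marg_nonneg simp: sum_marg_image)
  then show ?thesis by (simp only: ent_def[of _ _ g])
qed

text \<open>Nonnegativity of conditional mutual information given \<open>u\<close>: the triple is
  compared with the law \<open>Pf * Pg / Pu\<close> under which \<open>f\<close> and
  \<open>g\<close> are conditionally independent given \<open>u\<close>.\<close>

lemma ent_submodular:
  "ent \<Omega> m (\<lambda>\<omega>. ((f \<omega>, g \<omega>), u \<omega>)) + ent \<Omega> m u
    \<le> ent \<Omega> m (\<lambda>\<omega>. (f \<omega>, u \<omega>)) + ent \<Omega> m (\<lambda>\<omega>. (g \<omega>, u \<omega>))"
proof -
  define Pf where "Pf = marg \<Omega> m (\<lambda>\<omega>. (f \<omega>, u \<omega>))"
  define Pg where "Pg = marg \<Omega> m (\<lambda>\<omega>. (g \<omega>, u \<omega>))"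
  define Pu where "Pu = marg \<Omega> m u"
  define G where "G = (\<lambda>((a, b), c). Pf (a, c) * Pg (b, c) / Pu c)"
  have P: "0 < Pf (f \<omega>, u \<omega>)" "0 < Pg (g \<omega>, u \<omega>)" "0 < Pu (u \<omega>)" if "\<omega> \<in> \<Omega>" for \<omega>
    unfolding Pf_def Pg_def Pu_def using marg_pos[OF that, of "\<lambda>\<omega>. (f \<omega>, u \<omega>)"]
      marg_pos[OF that, of "\<lambda>\<omega>. (g \<omega>, u \<omega>)"] marg_pos[OF that, of u] by auto
  have "ent \<Omega> m (\<lambda>\<omega>. ((f \<omega>, g \<omega>), u \<omega>)) \<le> (\<Sum>\<omega>\<in>\<Omega>. m \<omega> * - log 2 (G ((f \<omega>, g \<omega>), u \<omega>)))"
  proof (rule ent_le_cross_entropy)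
    show "0 < G ((f \<omega>, g \<omega>), u \<omega>)" if "\<omega> \<in> \<Omega>" for \<omega>
      using P[OF that] by (simp add: G_def)
    have "(\<Sum>v\<in>(\<lambda>\<omega>. ((f \<omega>, g \<omega>), u \<omega>)) ` \<Omega>. G v) \<le> (\<Sum>v\<in>(f ` \<Omega> \<times> g ` \<Omega>) \<times> u ` \<Omega>. G v)"
      by (rule sum_mono2)
        (use fin in \<open>auto simp: G_def Pf_def Pg_def Pu_def
          intro!: divide_nonneg_nonneg mult_nonneg_nonneg marg_nonneg\<close>)
    also have "\<dots> = (\<Sum>p\<in>f ` \<Omega> \<times> g ` \<Omega>. \<Sum>c\<in>u ` \<Omega>. G (p, c))"
      by (simp add: sum.cartesian_product)
    also have "\<dots> = (\<Sum>c\<in>u ` \<Omega>. \<Sum>p\<in>f ` \<Omega> \<times> g ` \<Omega>. G (p, c))"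
      by (rule sum.swap)
    also have "\<dots> = (\<Sum>c\<in>u ` \<Omega>. (\<Sum>a\<in>f ` \<Omega>. Pf (a, c)) * (\<Sum>b\<in>g ` \<Omega>. Pg (b, c)) / Pu c)"
      by (simp add: sum_product sum_divide_distrib sum.cartesian_product G_def split_def)
    also have "\<dots> = (\<Sum>c\<in>u ` \<Omega>. Pu c)"
      unfolding Pf_def Pg_def Pu_def sum_marg_pair by (intro sum.cong refl) simp
    finally show "(\<Sum>v\<in>(\<lambda>\<omega>. ((f \<omega>, g \<omega>), u \<omega>)) ` \<Omega>. G v) \<le> 1"
      by (simp add: Pu_def sum_marg_image)
  qed
  also have "\<dots> = (\<Sum>\<omega>\<in>\<Omega>. m \<omega> * - log 2 (Pf (f \<omega>, u \<omega>)) + m \<omega> * - log 2 (Pg (g \<omega>, u \<omega>))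
      - m \<omega> * - log 2 (Pu (u \<omega>)))"
  proof (intro sum.cong refl)
    fix \<omega> assume w: "\<omega> \<in> \<Omega>"
    show "m \<omega> * - log 2 (G ((f \<omega>, g \<omega>), u \<omega>)) = m \<omega> * - log 2 (Pf (f \<omega>, u \<omega>))
        + m \<omega> * - log 2 (Pg (g \<omega>, u \<omega>)) - m \<omega> * - log 2 (Pu (u \<omega>))"
      using P[OF w] by (simp add: G_def log_mult log_divide algebra_simps)
  qed
  also have "\<dots> = ent \<Omega> m (\<lambda>\<omega>. (f \<omega>, u \<omega>)) + ent \<Omega> m (\<lambda>\<omega>. (g \<omega>, u \<omega>)) - ent \<Omega> m u"
    by (simp only: ent_def sum.distrib sum_subtractf Pf_def Pg_def Pu_def)
  finally show ?thesis by simp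
qed

end

section \<open>Uniform messages and an inequality of Fano type\<close>

lemma finite_weights_uniform:
  "finite M \<Longrightarrow> M \<noteq> {} \<Longrightarrow> finite_weights M (\<lambda>_. 1 / real (card M))"
  by unfold_locales (auto simp: card_gt_0_iff)

lemma marg_uniform:
  "marg M (\<lambda>_. 1 / real (card M)) f v = real (card {w\<in>M. f w = v}) / real (card M)"
  by (simp add: marg_def)

lemma entropy_unif_eq_ent:
  assumes "finite M"
  shows "entropy_unif M f = ent M (\<lambda>_. 1 / real (card M)) f"
proof -
  have "ent M (\<lambda>_. 1 / real (card M)) f = (\<Sum>v\<in>f ` M. \<Sum>w\<in>{w\<in>M. f w = v}.
      1 / real (card M) * - log 2 (marg M (\<lambda>_. 1 / real (card M)) f (f w)))"
    unfolding ent_def by (rule sum.image_gen[OF assms])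
  also have "\<dots> = (\<Sum>v\<in>f ` M. \<Sum>w\<in>{w\<in>M. f w = v}.
      1 / real (card M) * - log 2 (marg M (\<lambda>_. 1 / real (card M)) f v))"
    by (intro sum.cong) auto
  also have "\<dots> = entropy_unif M f"
    unfolding entropy_unif_def by (simp add: marg_uniform Let_def)
  finally show ?thesis by simp
qed

text \<open>Fibres of \<open>f\<close> lie inside fibres of \<open>g\<close>, so marginals grow and
  minus logarithms shrink.\<close>

lemma ent_uniform_mono:
  assumes M: "finite M" and fg: "\<And>w w'. w \<in> M \<Longrightarrow> w' \<in> M \<Longrightarrow> f w = f w' \<Longrightarrow> g w = g w'"
  shows "ent M (\<lambda>_. 1 / real (card M)) g \<le> ent M (\<lambda>_. 1 / real (card M)) f"
  unfolding ent_def
proof (intro sum_mono mult_left_mono)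
  fix w assume w: "w \<in> M"
  let ?m = "\<lambda>_. 1 / real (card M)"
  have "finite_weights M ?m" using M w by (intro finite_weights_uniform) auto
  then have pos: "0 < marg M ?m f (f w)" by (rule finite_weights.marg_pos[OF _ w])
  have "{w'\<in>M. f w' = f w} \<subseteq> {w'\<in>M. g w' = g w}" using fg w by blast
  then have "card {w'\<in>M. f w' = f w} \<le> card {w'\<in>M. g w' = g w}" using M by (intro card_mono) auto
  then have "marg M ?m f (f w) \<le> marg M ?m g (g w)"
    unfolding marg_uniform by (intro divide_right_mono) auto
  then show "- log 2 (marg M ?m g (g w)) \<le> - log 2 (marg M ?m f (f w))"
    using pos by simp
qed simp

text \<open>Every fibre of \<open>f\<close> contains at most one correctly decoded message, so a fibre of size
  \<open>k \<ge> 2\<close> contains at least \<open>k / 2\<close> wrongly decoded ones.\<close>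
lemma fano_uniform:
  assumes M: "finite M" "M \<noteq> {}"
    and err: "real (card {w\<in>M. d (f w) \<noteq> w}) \<le> e * real (card M)"
  shows "(1 - 2 * e) * log 2 (real (card M)) \<le> ent M (\<lambda>_. 1 / real (card M)) f"
proof -
  define N where "N = real (card M)"
  define k where "k = (\<lambda>v. card {w\<in>M. f w = v})"
  have N: "1 \<le> N" using M by (simp add: N_def Suc_le_eq card_gt_0_iff)
  have kpos: "0 < k v" if "v \<in> f ` M" for v
    using that M unfolding k_def by (auto simp: card_gt_0_iff)
  have kN: "real (k v) \<le> N" for v
    unfolding k_def N_def using M by (intro of_nat_mono card_mono) auto
  have fibre: "real (k v) * log 2 (real (k v)) \<le> 2 * real (card {w\<in>M. f w = v \<and> d v \<noteq> w}) * log 2 N"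
    if v: "v \<in> f ` M" for v
  proof (cases "k v = 1")
    case False
    then have k2: "2 \<le> k v" using kpos[OF v] by linarith
    have "k v \<le> card (insert (d v) {w\<in>M. f w = v \<and> d v \<noteq> w})"
      unfolding k_def using M by (intro card_mono) auto
    also have "\<dots> \<le> 1 + card {w\<in>M. f w = v \<and> d v \<noteq> w}"
      by (simp add: card_insert_if M)
    finally have "k v \<le> 2 * card {w\<in>M. f w = v \<and> d v \<noteq> w}" using k2 by linarith
    then have "real (k v) \<le> 2 * real (card {w\<in>M. f w = v \<and> d v \<noteq> w})" by linarith
    moreover have "log 2 (real (k v)) \<le> log 2 N" "0 \<le> log 2 (real (k v))"
      using k2 kN[of v] by auto
    ultimately show ?thesis by (intro mult_mono) auto
  qed (use N in simp)
  have "(\<Sum>w\<in>M. log 2 (real (k (f w)))) = (\<Sum>v\<in>f ` M. \<Sum>w\<in>{w\<in>M. f w = v}. log 2 (real (k (f w))))"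
    by (rule sum.image_gen[OF M(1)])
  also have "\<dots> = (\<Sum>v\<in>f ` M. \<Sum>w\<in>{w\<in>M. f w = v}. log 2 (real (k v)))"
    by (intro sum.cong) auto
  also have "\<dots> = (\<Sum>v\<in>f ` M. real (k v) * log 2 (real (k v)))"
    by (simp add: k_def)
  also have "\<dots> \<le> (\<Sum>v\<in>f ` M. 2 * real (card {w\<in>M. f w = v \<and> d v \<noteq> w}) * log 2 N)"
    by (intro sum_mono fibre)
  also have "\<dots> = 2 * real (\<Sum>v\<in>f ` M. card {w\<in>M. f w = v \<and> d v \<noteq> w}) * log 2 N"
    by (simp add: sum_distrib_left sum_distrib_right)
  also have "(\<Sum>v\<in>f ` M. card {w\<in>M. f w = v \<and> d v \<noteq> w}) = card {w\<in>M. d (f w) \<noteq> w}"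
  proof -
    have "(\<Union>v\<in>f ` M. {w\<in>M. f w = v \<and> d v \<noteq> w}) = {w\<in>M. d (f w) \<noteq> w}" by auto
    moreover have "card (\<Union>v\<in>f ` M. {w\<in>M. f w = v \<and> d v \<noteq> w})
        = (\<Sum>v\<in>f ` M. card {w\<in>M. f w = v \<and> d v \<noteq> w})"
      by (rule card_UN_disjoint) (use M in auto)
    ultimately show ?thesis by simp
  qed
  also have "2 * real (card {w\<in>M. d (f w) \<noteq> w}) * log 2 N \<le> 2 * (e * N) * log 2 N"
    using err N by (intro mult_right_mono mult_left_mono) (auto simp: N_def)
  finally have *: "(\<Sum>w\<in>M. log 2 (real (k (f w)))) \<le> 2 * (e * N) * log 2 N" .
  \<comment> \<open>For the uniform law the entropy is \<open>log 2 N\<close> minus the mean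
    logarithm of the fibre size, which has just been bounded.\<close>
  have "ent M (\<lambda>_. 1 / real (card M)) f = (\<Sum>w\<in>M. (log 2 N - log 2 (real (k (f w)))) / N)"
    unfolding ent_def marg_uniform
  proof (intro sum.cong refl)
    fix w assume "w \<in> M"
    then have "0 < k (f w)" using kpos by auto
    then show "1 / real (card M) * - log 2 (real (card {w' \<in> M. f w' = f w}) / real (card M))
        = (log 2 N - log 2 (real (k (f w)))) / N"
      using N by (simp add: k_def N_def log_divide minus_divide_left)
  qed
  also have "\<dots> = log 2 N - (\<Sum>w\<in>M. log 2 (real (k (f w)))) / N"
    using N by (simp add: sum_divide_distrib[symmetric] sum_subtractf N_def diff_divide_distrib)
  also have "\<dots> \<ge> log 2 N - 2 * (e * N) * log 2 N / N"
    using divide_right_mono[OF *, of N] N by simp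
  also have "log 2 N - 2 * (e * N) * log 2 N / N = (1 - 2 * e) * log 2 N"
    using N by (simp add: field_simps)
  finally show ?thesis by (simp add: N_def)
qed

section \<open>Entropies in the presence of a noisy observation\<close>

locale observation =
  fixes M :: "'w set" and L :: "'u set" and T :: "'w \<Rightarrow> 'u \<Rightarrow> real"
  assumes M: "finite M" "M \<noteq> {}" and L: "finite L"
    and T_pos: "\<And>w u. w \<in> M \<Longrightarrow> u \<in> L \<Longrightarrow> 0 < T w u"
    and T_sum: "\<And>w. w \<in> M \<Longrightarrow> (\<Sum>u\<in>L. T w u) = 1"
begin

abbreviation unif :: "'w \<Rightarrow> real" where "unif \<equiv> (\<lambda>_. 1 / real (card M))"

text \<open>Law of a uniform message together with an auxiliary \<open>u\<close> whose conditional
  law given the message \<open>w\<close> is \<open>T w\<close>.\<close>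

definition joint :: "'w \<times> 'u \<Rightarrow> real" where "joint = (\<lambda>(w, u). T w u / real (card M))"

lemma card_pos: "0 < real (card M)"
  using M by (simp add: card_gt_0_iff)

lemma sum_joint: "A \<subseteq> M \<Longrightarrow> (\<Sum>\<omega>\<in>A \<times> L. joint \<omega> * \<phi> (fst \<omega>)) = (\<Sum>w\<in>A. unif w * \<phi> w)"
proof -
  assume A: "A \<subseteq> M"
  have "(\<Sum>\<omega>\<in>A \<times> L. joint \<omega> * \<phi> (fst \<omega>)) = (\<Sum>w\<in>A. \<Sum>u\<in>L. T w u / real (card M) * \<phi> w)"
    by (simp add: sum.cartesian_product joint_def split_def)
  also have "\<dots> = (\<Sum>w\<in>A. (\<Sum>u\<in>L. T w u) * (unif w * \<phi> w))"
    by (intro sum.cong refl) (simp add: sum_distrib_right sum_divide_distrib)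
  also have "\<dots> = (\<Sum>w\<in>A. unif w * \<phi> w)"
    by (intro sum.cong refl) (use A T_sum in auto)
  finally show ?thesis .
qed

sublocale finite_weights "M \<times> L" joint
proof
  show "sum joint (M \<times> L) = 1"
    using sum_joint[of M "\<lambda>_. 1"] card_pos by simp
qed (use M L T_pos card_pos in \<open>auto simp: joint_def\<close>)

text \<open>Summing out the observation returns the uniform law, so functions of the message alone
  keep their entropy.\<close>

lemma ent_fst: "ent (M \<times> L) joint (\<lambda>\<omega>. f (fst \<omega>)) = ent M unif f"
proof -
  have "marg (M \<times> L) joint (\<lambda>\<omega>. f (fst \<omega>)) v = marg M unif f v" for v
  proof -
    have "{\<omega>\<in>M \<times> L. f (fst \<omega>) = v} = {w\<in>M. f w = v} \<times> L" by auto
    then show ?thesis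
      unfolding marg_def using sum_joint[of "{w\<in>M. f w = v}" "\<lambda>_. 1"] by simp
  qed
  then show ?thesis
    unfolding ent_def using sum_joint[of M "\<lambda>w. - log 2 (marg M unif f (f w))"] by simp
qed

text \<open>Exact chain rule: as \<open>T w\<close> depends on \<open>w\<close> only through
  \<open>f w\<close>, the marginal of the pair factors into the marginal of \<open>f\<close> and
  \<open>T\<close>.\<close>

lemma ent_fst_snd:
  assumes det: "\<And>w w' u. w \<in> M \<Longrightarrow> w' \<in> M \<Longrightarrow> u \<in> L \<Longrightarrow> f w = f w' \<Longrightarrow> T w u = T w' u"
  shows "ent (M \<times> L) joint (\<lambda>\<omega>. (f (fst \<omega>), snd \<omega>))
    = ent M unif f + (\<Sum>\<omega>\<in>M \<times> L. joint \<omega> * - log 2 (T (fst \<omega>) (snd \<omega>)))"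
proof -
  have marg: "marg (M \<times> L) joint (\<lambda>\<omega>. (f (fst \<omega>), snd \<omega>)) (f w, u) = marg M unif f (f w) * T w u"
    if "w \<in> M" "u \<in> L" for w u
  proof -
    have "{\<omega>\<in>M \<times> L. (f (fst \<omega>), snd \<omega>) = (f w, u)} = {w'\<in>M. f w' = f w} \<times> {u}"
      using that by auto
    then have "marg (M \<times> L) joint (\<lambda>\<omega>. (f (fst \<omega>), snd \<omega>)) (f w, u)
        = (\<Sum>w'\<in>{w'\<in>M. f w' = f w}. T w' u / real (card M))"
      unfolding marg_def by (simp add: sum.cartesian_product[symmetric] joint_def)
    also have "\<dots> = (\<Sum>w'\<in>{w'\<in>M. f w' = f w}. T w u / real (card M))"
    proof (intro sum.cong refl)
      fix w' assume "w' \<in> {w'\<in>M. f w' = f w}"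
      then have "T w' u = T w u" by (intro det) (use that in auto)
      then show "T w' u / real (card M) = T w u / real (card M)" by simp
    qed
    finally show ?thesis by (simp add: marg_uniform)
  qed
  have mpos: "0 < marg M unif f (f w)" if "w \<in> M" for w
    using finite_weights.marg_pos[OF finite_weights_uniform[OF M] that] .
  have "ent (M \<times> L) joint (\<lambda>\<omega>. (f (fst \<omega>), snd \<omega>)) = (\<Sum>\<omega>\<in>M \<times> L.
      joint \<omega> * - log 2 (marg M unif f (f (fst \<omega>))) + joint \<omega> * - log 2 (T (fst \<omega>) (snd \<omega>)))"
    unfolding ent_def
  proof (intro sum.cong refl)
    fix \<omega> assume "\<omega> \<in> M \<times> L"
    then have w: "fst \<omega> \<in> M" "snd \<omega> \<in> L" by auto
    show "joint \<omega> * - log 2 (marg (M \<times> L) joint (\<lambda>\<omega>. (f (fst \<omega>), snd \<omega>)) (f (fst \<omega>), snd \<omega>))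
        = joint \<omega> * - log 2 (marg M unif f (f (fst \<omega>))) + joint \<omega> * - log 2 (T (fst \<omega>) (snd \<omega>))"
      unfolding marg[OF w] using mpos[OF w(1)] T_pos[OF w] by (simp add: log_mult algebra_simps)
  qed
  also have "\<dots> = ent M unif f + (\<Sum>\<omega>\<in>M \<times> L. joint \<omega> * - log 2 (T (fst \<omega>) (snd \<omega>)))"
    unfolding sum.distrib ent_def[of M]
    by (subst sum_joint[of M "\<lambda>w. - log 2 (marg M unif f (f w))", OF subset_refl]) (rule refl)
  finally show ?thesis .
qed

text \<open>The noisy observation \<open>u\<close> of \<open>y\<close> lower-bounds the dependence of \<open>f\<^sub>1\<close> and \<open>f\<^sub>2\<close>
  through \<open>I(f\<^sub>1; f\<^sub>2) \<ge> I(f\<^sub>1; u) - I(f\<^sub>1; u | f\<^sub>2)\<close>.\<close>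
lemma two_encoder_bound:
  assumes y: "\<And>w w'. w \<in> M \<Longrightarrow> w' \<in> M \<Longrightarrow> f1 w = f1 w' \<Longrightarrow> f2 w = f2 w' \<Longrightarrow> y w = y w'"
    and T_y: "\<And>w w' u. w \<in> M \<Longrightarrow> w' \<in> M \<Longrightarrow> u \<in> L \<Longrightarrow> y w = y w' \<Longrightarrow> T w u = T w' u"
    and Q1: "\<And>w u. w \<in> M \<Longrightarrow> u \<in> L \<Longrightarrow> 0 < Q1 (f1 w) u" "\<And>w. w \<in> M \<Longrightarrow> (\<Sum>u\<in>L. Q1 (f1 w) u) \<le> 1"
    and Q2: "\<And>w u. w \<in> M \<Longrightarrow> u \<in> L \<Longrightarrow> 0 < Q2 (f2 w) u" "\<And>w. w \<in> M \<Longrightarrow> (\<Sum>u\<in>L. Q2 (f2 w) u) \<le> 1"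
    and Qy: "\<And>w u. w \<in> M \<Longrightarrow> u \<in> L \<Longrightarrow> 0 < Qy u (y w)" "\<And>u. u \<in> L \<Longrightarrow> (\<Sum>v\<in>y ` M. Qy u v) \<le> 1"
    and c: "\<And>w u. w \<in> M \<Longrightarrow> u \<in> L \<Longrightarrow> Q1 (f1 w) u * Q2 (f2 w) u * Qy u (y w) = (T w u)\<^sup>2 * c w"
  shows "ent M unif (\<lambda>w. (f1 w, f2 w)) + ent M unif y
    \<le> ent M unif f1 + ent M unif f2 + (\<Sum>w\<in>M. unif w * - log 2 (c w))"
proof -
  let ?H = "\<lambda>f. ent (M \<times> L) joint f"
  let ?E = "\<lambda>\<phi>. \<Sum>\<omega>\<in>M \<times> L. joint \<omega> * \<phi> (fst \<omega>) (snd \<omega>)"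
  have L0: "L \<noteq> {}"
  proof
    assume "L = {}"
    moreover obtain w where "w \<in> M" using M by blast
    ultimately show False using T_sum[of w] by simp
  qed
  have snd: "snd ` (M \<times> L) = L" using M by force
  have fst: "(\<lambda>\<omega>. y (fst \<omega>)) ` (M \<times> L) = y ` M" using L0 by force
  \<comment> \<open>Claims \<open>1\<close> to \<open>3\<close> replace conditional entropies by
    cross entropies against \<open>Q1\<close>, \<open>Q2\<close>, \<open>Qy\<close>. Claims
    \<open>4\<close> and \<open>5\<close> are exact, since the observation depends on the message
    only through \<open>y\<close>.\<close>
  have 1: "?H (\<lambda>\<omega>. (f1 (fst \<omega>), snd \<omega>)) \<le> ent M unif f1 + ?E (\<lambda>w u. - log 2 (Q1 (f1 w) u))"
    unfolding ent_fst[symmetric] by (rule ent_chain_le) (auto simp: snd Q1 less_imp_le)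
  have 2: "?H (\<lambda>\<omega>. (f2 (fst \<omega>), snd \<omega>)) \<le> ent M unif f2 + ?E (\<lambda>w u. - log 2 (Q2 (f2 w) u))"
    unfolding ent_fst[symmetric] by (rule ent_chain_le) (auto simp: snd Q2 less_imp_le)
  have 3: "?H (\<lambda>\<omega>. (snd \<omega>, y (fst \<omega>))) \<le> ?H snd + ?E (\<lambda>w u. - log 2 (Qy u (y w)))"
    by (rule ent_chain_le) (auto simp: fst Qy less_imp_le)
  have 4: "?H (\<lambda>\<omega>. (snd \<omega>, y (fst \<omega>))) = ent M unif y + ?E (\<lambda>w u. - log 2 (T w u))"
  proof -
    have "?H (\<lambda>\<omega>. (snd \<omega>, y (fst \<omega>))) = ?H (\<lambda>\<omega>. (y (fst \<omega>), snd \<omega>))"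
      by (rule ent_eq_if_same_kernel) auto
    also have "\<dots> = ent M unif y + ?E (\<lambda>w u. - log 2 (T w u))"
      by (rule ent_fst_snd) (rule T_y)
    finally show ?thesis .
  qed
  have 5: "?H (\<lambda>\<omega>. ((f1 (fst \<omega>), f2 (fst \<omega>)), snd \<omega>))
      = ent M unif (\<lambda>w. (f1 w, f2 w)) + ?E (\<lambda>w u. - log 2 (T w u))"
    by (rule ent_fst_snd) (use T_y y in blast)
  have 6: "?H (\<lambda>\<omega>. ((f1 (fst \<omega>), f2 (fst \<omega>)), snd \<omega>)) + ?H snd
      \<le> ?H (\<lambda>\<omega>. (f1 (fst \<omega>), snd \<omega>)) + ?H (\<lambda>\<omega>. (f2 (fst \<omega>), snd \<omega>))"
    by (rule ent_submodular)
  \<comment> \<open>By hypothesis \<open>c\<close> the squared \<open>T\<close> cancels inside the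
    logarithms, leaving a cost free of \<open>u\<close>.\<close>
  have "?E (\<lambda>w u. - log 2 (Q1 (f1 w) u)) + ?E (\<lambda>w u. - log 2 (Q2 (f2 w) u))
      + ?E (\<lambda>w u. - log 2 (Qy u (y w))) - 2 * ?E (\<lambda>w u. - log 2 (T w u)) = ?E (\<lambda>w u. - log 2 (c w))"
    unfolding sum.distrib[symmetric] sum_subtractf[symmetric] sum_distrib_left
  proof (intro sum.cong refl)
    fix \<omega> assume "\<omega> \<in> M \<times> L"
    then obtain w u where w: "\<omega> = (w, u)" "w \<in> M" "u \<in> L" by auto
    note q = Q1(1)[OF w(2,3)] Q2(1)[OF w(2,3)] Qy(1)[OF w(2,3)] T_pos[OF w(2,3)] c[OF w(2,3)]
    have "0 < (T w u)\<^sup>2 * c w" unfolding q(5)[symmetric] using q(1-3) by simp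
    then have cpos: "0 < c w" using q(4) by (simp add: zero_less_mult_iff)
    have "log 2 (Q1 (f1 w) u * Q2 (f2 w) u * Qy u (y w)) = log 2 ((T w u)\<^sup>2 * c w)"
      using q(5) by simp
    then have "log 2 (Q1 (f1 w) u) + log 2 (Q2 (f2 w) u) + log 2 (Qy u (y w))
        = 2 * log 2 (T w u) + log 2 (c w)"
      using q(1-4) cpos by (simp add: log_mult log_nat_power)
    then have log_c: "log 2 (c w)
        = log 2 (Q1 (f1 w) u) + log 2 (Q2 (f2 w) u) + log 2 (Qy u (y w)) - 2 * log 2 (T w u)"
      by simp
    show "joint \<omega> * - log 2 (Q1 (f1 (fst \<omega>)) (snd \<omega>)) + joint \<omega> * - log 2 (Q2 (f2 (fst \<omega>)) (snd \<omega>))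
        + joint \<omega> * - log 2 (Qy (snd \<omega>) (y (fst \<omega>))) - 2 * (joint \<omega> * - log 2 (T (fst \<omega>) (snd \<omega>)))
        = joint \<omega> * - log 2 (c (fst \<omega>))"
      unfolding w(1) fst_conv snd_conv log_c by (simp add: algebra_simps)
  qed
  also have "\<dots> = (\<Sum>w\<in>M. unif w * - log 2 (c w))"
    by (rule sum_joint) simp
  \<comment> \<open>Adding \<open>3\<close> and \<open>6\<close> cancels the entropy of
    \<open>u\<close>; \<open>4\<close> and \<open>5\<close> contribute the \<open>T\<close> term
    twice.\<close>
  finally show ?thesis using 1 2 3 4 5 6 by linarith
qed

end

section \<open>Letterwise bounds for the binary adder\<close>

text \<open>A memoryless channel: \<open>q a b\<close> is the probability of output letter
  \<open>a\<close> given input letter \<open>b\<close>, so \<open>xs\<close> is the output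
  word.\<close>

definition seq_prob :: "('a \<Rightarrow> 'b \<Rightarrow> real) \<Rightarrow> 'a list \<Rightarrow> 'b list \<Rightarrow> real" where
  "seq_prob q xs ys = prod_list (map2 q xs ys)"

lemma seq_prob_simps [simp]:
  "seq_prob q [] ys = 1" "seq_prob q (x # xs) (y # ys) = q x y * seq_prob q xs ys"
  by (simp_all add: seq_prob_def)

lemma seq_prob_pos: "(\<And>a b. 0 < q a b) \<Longrightarrow> 0 < seq_prob q xs ys"
  unfolding seq_prob_def by (induction xs ys rule: list_induct2') auto

lemma sum_seq_prob:
  assumes "finite S" and "\<And>b. (\<Sum>a\<in>S. q a b) = 1"
  shows "length ys = n \<Longrightarrow> (\<Sum>xs\<in>{xs. set xs \<subseteq> S \<and> length xs = n}. seq_prob q xs ys) = 1"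
proof (induction n arbitrary: ys)
  case 0
  have "{xs. set xs \<subseteq> S \<and> length xs = 0} = {[]}" by auto
  then show ?case by simp
next
  case (Suc n)
  then obtain b bs where ys: "ys = b # bs" "length bs = n" by (cases ys) auto
  let ?L = "{xs. set xs \<subseteq> S \<and> length xs = n}"
  have inj: "inj_on (\<lambda>(xs, a). a # xs) (?L \<times> S)" by (auto simp: inj_on_def)
  have "(\<Sum>xs\<in>{xs. set xs \<subseteq> S \<and> length xs = Suc n}. seq_prob q xs ys)
      = (\<Sum>(xs, a)\<in>?L \<times> S. q a b * seq_prob q xs bs)"
    unfolding lists_length_Suc_eq sum.reindex[OF inj] by (intro sum.cong) (auto simp: ys)
  also have "\<dots> = (\<Sum>xs\<in>?L. (\<Sum>a\<in>S. q a b) * seq_prob q xs bs)"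
    by (simp add: sum.cartesian_product[symmetric] sum_distrib_right)
  also have "\<dots> = 1" using Suc.IH[OF ys(2)] assms(2) by simp
  finally show ?case .
qed

lemma adder_out_simps [simp]:
  "adder_out [] ys = []"
  "adder_out (a # xs) (b # ys) = (of_bool a + of_bool b) # adder_out xs ys"
  by (simp_all add: adder_out_def)

lemma length_adder_out [simp]: "length (adder_out xs ys) = min (length xs) (length ys)"
  by (simp add: adder_out_def)

lemma set_adder_out: "set (adder_out xs ys) \<subseteq> {0, 1, 2}"
  by (induction xs ys rule: list_induct2') (auto simp: adder_out_def)

lemma log_prod_list_if:
  fixes a b :: real
  assumes "0 < a" "0 < b"
  shows "0 < prod_list (map (\<lambda>v. if v = k then a else b) vs)
    \<and> log 2 (prod_list (map (\<lambda>v. if v = k then a else b) vs))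
      = real (count_list vs k) * log 2 a + (real (length vs) - real (count_list vs k)) * log 2 b"
  by (induction vs) (use assms in \<open>auto simp: log_mult algebra_simps\<close>)

text \<open>For a doubly symmetric binary pair \<open>X\<^sub>1, X\<^sub>2\<close> with crossover probability
  \<open>p = 2a(1 - a)\<close>, both obtained from a uniform bit \<open>U\<close> by independent flips of probability
  \<open>a\<close>: the law of \<open>X\<^sub>i\<close> given \<open>U\<close> (or conversely), of \<open>U\<close> given \<open>Y = X\<^sub>1 + X\<^sub>2\<close>,
  and of \<open>Y\<close> given \<open>U\<close>.\<close>
definition flip_law :: "real \<Rightarrow> bool \<Rightarrow> bool \<Rightarrow> real" where
  "flip_law a u x = (if u = x then 1 - a else a)"

definition post_law :: "real \<Rightarrow> bool \<Rightarrow> nat \<Rightarrow> real" where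
  "post_law a u y = (if y = 1 then 1/2
     else (if u = (y = 2) then (1 - a)\<^sup>2 else a\<^sup>2) / (1 - 2 * a * (1 - a)))"

definition sum_law :: "real \<Rightarrow> nat \<Rightarrow> bool \<Rightarrow> real" where
  "sum_law a y u = (if y = 1 then 2 * a * (1 - a) else if u = (y = 2) then (1 - a)\<^sup>2 else a\<^sup>2)"

text \<open>Bayes' rule with a uniform bit \<open>U\<close>: by the Markov property the two flips
  multiply to \<open>2 * P(u | y) * P(x1, x2)\<close>, and the law of the sum given \<open>u\<close>
  is \<open>2 * P(u | y) * P(y)\<close>. The remaining factor \<open>4 * P(x1, x2) * P(y)\<close> is
  \<open>2 * p\<^sup>2\<close> for the sum 1 and \<open>(1 - p)\<^sup>2\<close> otherwise.\<close>

lemma laws_factor: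
  fixes a :: real
  defines "p \<equiv> 2 * a * (1 - a)"
  assumes "p \<noteq> 1"
  shows "flip_law a u x1 * flip_law a u x2 * sum_law a (of_bool x1 + of_bool x2) u
    = (post_law a u (of_bool x1 + of_bool x2))\<^sup>2
      * (if (of_bool x1 + of_bool x2 :: nat) = 1 then 2 * p\<^sup>2 else (1 - p)\<^sup>2)"
proof -
  have "1 - p \<noteq> 0" using assms by simp
  then show ?thesis
    by (cases u; cases x1; cases x2)
      (simp_all add: flip_law_def sum_law_def post_law_def p_def[symmetric] power2_eq_square,
       simp_all add: p_def algebra_simps)
qed

lemma seq_laws_factor:
  fixes a :: real
  defines "p \<equiv> 2 * a * (1 - a)"
  assumes p: "p \<noteq> 1" and len: "length us = length xs" "length xs = length ys"
  shows "seq_prob (flip_law a) us xs * seq_prob (flip_law a) us ys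
      * seq_prob (sum_law a) (adder_out xs ys) us
    = (seq_prob (post_law a) us (adder_out xs ys))\<^sup>2
      * prod_list (map (\<lambda>v. if v = 1 then 2 * p\<^sup>2 else (1 - p)\<^sup>2) (adder_out xs ys))"
  using len
proof (induction us xs ys rule: list_induct3)
  case (Cons u us x xs y ys)
  let ?z = "of_bool x + of_bool y :: nat"
  let ?c = "\<lambda>v::nat. if v = 1 then 2 * p\<^sup>2 else (1 - p)\<^sup>2"
  have "seq_prob (flip_law a) (u # us) (x # xs) * seq_prob (flip_law a) (u # us) (y # ys)
        * seq_prob (sum_law a) (adder_out (x # xs) (y # ys)) (u # us)
      = (flip_law a u x * flip_law a u y * sum_law a ?z u)
        * (seq_prob (flip_law a) us xs * seq_prob (flip_law a) us ys
        * seq_prob (sum_law a) (adder_out xs ys) us)"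
    by simp
  also have "\<dots> = ((post_law a u ?z)\<^sup>2 * ?c ?z) * ((seq_prob (post_law a) us (adder_out xs ys))\<^sup>2
      * prod_list (map ?c (adder_out xs ys)))"
    using laws_factor[of a u x y] p Cons.IH unfolding p_def by simp
  also have "\<dots> = (seq_prob (post_law a) (u # us) (adder_out (x # xs) (y # ys)))\<^sup>2
      * prod_list (map ?c (adder_out (x # xs) (y # ys)))"
    by (simp only: adder_out_simps seq_prob_simps list.map prod_list.Cons power_mult_distrib ac_simps)
  finally show ?case .
qed simp

text \<open>The cost of a word depends only on how often \<open>k\<close> occurs in it, so the mean
  cost is affine in the mean count.\<close>

lemma sum_two_type_cost:
  assumes "finite M" "M \<noteq> {}" and "\<And>w. w \<in> M \<Longrightarrow> length (y w) = n" and "0 < a" "0 < b"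
  shows "(\<Sum>w\<in>M. 1 / real (card M) * - log 2 (prod_list (map (\<lambda>v. if v = k then a else b) (y w))))
    = (\<Sum>w\<in>M. 1 / real (card M) * real (count_list (y w) k)) * - log 2 a
      + (real n - (\<Sum>w\<in>M. 1 / real (card M) * real (count_list (y w) k))) * - log 2 b"
proof -
  let ?m = "1 / real (card M)" and ?k = "\<lambda>w. real (count_list (y w) k)"
  have "(\<Sum>w\<in>M. ?m) = 1" using assms by simp
  have "(\<Sum>w\<in>M. ?m * - log 2 (prod_list (map (\<lambda>v. if v = k then a else b) (y w))))
      = (\<Sum>w\<in>M. ?m * ?k w * - log 2 a + (?m * real n - ?m * ?k w) * - log 2 b)"
    by (intro sum.cong refl) (simp add: log_prod_list_if assms algebra_simps)
  also have "\<dots> = (\<Sum>w\<in>M. ?m * ?k w) * - log 2 a + (\<Sum>w\<in>M. ?m * real n - ?m * ?k w) * - log 2 b"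
    unfolding sum.distrib sum_distrib_right ..
  also have "(\<Sum>w\<in>M. ?m * real n - ?m * ?k w) = real n - (\<Sum>w\<in>M. ?m * ?k w)"
    unfolding sum_subtractf sum_distrib_right[symmetric] \<open>(\<Sum>w\<in>M. ?m) = 1\<close> by simp
  finally show ?thesis .
qed

text \<open>Cross entropy against the product law with mass \<open>p\<close> at 1 and
  \<open>(1 - p) / 2\<close> at each of 0 and 2.\<close>

lemma entropy_adder_output_le:
  assumes M: "finite M" "M \<noteq> {}" and y: "\<And>w. w \<in> M \<Longrightarrow> length (y w) = n \<and> set (y w) \<subseteq> {0, 1, 2}"
    and p: "0 < p" "p < 1"
  defines "q \<equiv> \<Sum>w\<in>M. 1 / real (card M) * real (count_list (y w) (1::nat))"
  shows "ent M (\<lambda>_. 1 / real (card M)) y \<le> q * - log 2 p + (real n - q) * (1 - log 2 (1 - p))"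
proof -
  interpret finite_weights M "\<lambda>_. 1 / real (card M)" by (rule finite_weights_uniform[OF M])
  let ?c = "\<lambda>v::nat. if v = 1 then p else (1 - p) / 2"
  let ?Y = "{vs. set vs \<subseteq> {0, 1, 2::nat} \<and> length vs = n}"
  have pos: "0 < prod_list (map ?c vs)" for vs :: "nat list"
    by (induction vs) (use p in auto)
  \<comment> \<open>The product law is viewed as a channel with the one-letter input alphabet
    \<open>unit\<close>, so that \<open>sum_seq_prob\<close> applies.\<close>
  have eq: "seq_prob (\<lambda>v (_::unit). ?c v) vs (replicate n ()) = prod_list (map ?c vs)"
    if "length vs = n" for vs
    using that by (induction vs arbitrary: n) auto
  have "(\<Sum>vs\<in>y ` M. prod_list (map ?c vs)) \<le> (\<Sum>vs\<in>?Y. prod_list (map ?c vs))"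
    by (rule sum_mono2) (use y pos in \<open>auto intro: finite_lists_length_eq less_imp_le\<close>)
  also have "\<dots> = (\<Sum>vs\<in>?Y. seq_prob (\<lambda>v (_::unit). ?c v) vs (replicate n ()))"
    by (intro sum.cong refl) (use eq in auto)
  also have "\<dots> = 1" by (rule sum_seq_prob) (auto simp: field_simps)
  finally have "ent M (\<lambda>_. 1 / real (card M)) y
      \<le> (\<Sum>w\<in>M. 1 / real (card M) * - log 2 (prod_list (map ?c (y w))))"
    by (intro ent_le_cross_entropy[where G = "\<lambda>vs. prod_list (map ?c vs)"] pos)
  also have "\<dots> = q * - log 2 p + (real n - q) * - log 2 ((1 - p) / 2)"
    unfolding q_def by (rule sum_two_type_cost) (use M y p in auto)
  also have "- log 2 ((1 - p) / 2) = 1 - log 2 (1 - p)"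
    using p by (simp add: log_divide)
  finally show ?thesis .
qed

text \<open>The noisy observation is taken letterwise with \<open>post_law\<close>. The resulting
  cost per letter is \<open>- log 2 (2 * p\<^sup>2)\<close> where the relay inputs differ and
  \<open>- log 2 ((1 - p)\<^sup>2)\<close> where they agree.\<close>

lemma entropy_diamond_le:
  fixes f1 :: "'w \<Rightarrow> 'v" and f2 :: "'w \<Rightarrow> 'z"
  assumes M: "finite M" "M \<noteq> {}"
    and len: "\<And>v. length (g1 v) = n" "\<And>v. length (g2 v) = n"
    and p: "0 < p" "p \<le> 1/2"
  defines "y \<equiv> \<lambda>w. adder_out (g1 (f1 w)) (g2 (f2 w))"
  defines "q \<equiv> \<Sum>w\<in>M. 1 / real (card M) * real (count_list (y w) 1)"
  shows "ent M (\<lambda>_. 1 / real (card M)) (\<lambda>w. (f1 w, f2 w)) + ent M (\<lambda>_. 1 / real (card M)) y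
    \<le> ent M (\<lambda>_. 1 / real (card M)) f1 + ent M (\<lambda>_. 1 / real (card M)) f2
      + (q * (- 2 * log 2 p - 1) + (real n - q) * (- 2 * log 2 (1 - p)))"
proof -
  \<comment> \<open>\<open>a\<close> is the smaller root of \<open>2 * a * (1 - a) = p\<close>, real
    because \<open>p \<le> 1/2\<close>.\<close>
  define s where "s = sqrt (1 - 2 * p)"
  define a where "a = (1 - s) / 2"
  have s: "0 \<le> s" "s < 1" "s\<^sup>2 = 1 - 2 * p" using p by (auto simp: s_def)
  then have a: "0 < a" "a < 1" by (auto simp: a_def)
  have "2 * a * (1 - a) = (1 - s\<^sup>2) / 2"
    unfolding a_def by (simp add: field_simps power2_eq_square)
  then have pa: "2 * a * (1 - a) = p" using s by simp
  then have p1: "(1 - a)\<^sup>2 + a\<^sup>2 = 1 - p" by (simp add: power2_eq_square algebra_simps)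
  let ?L = "{u :: bool list. length u = n}"
  have finL: "finite ?L" using finite_lists_length_eq[of "UNIV :: bool set" n] by simp
  have sumL: "(\<Sum>u\<in>?L. seq_prob r u vs) = 1"
    if "\<And>b. (\<Sum>u\<in>UNIV. r u b) = 1" "length vs = n" for r vs
    using sum_seq_prob[of "UNIV :: bool set" r vs n] that by simp
  let ?c = "\<lambda>v::nat. if v = 1 then 2 * p\<^sup>2 else (1 - p)\<^sup>2"
  have leny: "length (y w) = n" for w by (simp add: y_def len)
  have flip: "0 < flip_law a u x" "(\<Sum>u\<in>UNIV. flip_law a u x) = 1" for u x
    using a by (auto simp: flip_law_def UNIV_bool)
  have post: "0 < post_law a u v" "(\<Sum>u\<in>UNIV. post_law a u v) = 1" for u v
    using a p p1 unfolding post_law_def pa by (auto simp: UNIV_bool add_divide_distrib[symmetric] add.commute)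
  have suml: "0 < sum_law a v u" "(\<Sum>v\<in>{0, 1, 2}. sum_law a v u) = 1" for u v
    using a p p1 unfolding sum_law_def pa by (auto simp: add.commute add.left_commute)
  interpret observation M ?L "\<lambda>w u. seq_prob (post_law a) u (y w)"
    by unfold_locales (use M finL in \<open>auto intro!: seq_prob_pos sumL post simp: leny\<close>)
  \<comment> \<open>The kernels are the laws, for the symmetric pair, of \<open>u\<close> given
    either relay's word and of the output word given \<open>u\<close>.\<close>
  have "ent M unif (\<lambda>w. (f1 w, f2 w)) + ent M unif y
      \<le> ent M unif f1 + ent M unif f2 + (\<Sum>w\<in>M. unif w * - log 2 (prod_list (map ?c (y w))))"
  proof (rule two_encoder_bound[where ?Q1.0 = "\<lambda>v u. seq_prob (flip_law a) u (g1 v)"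
        and ?Q2.0 = "\<lambda>v u. seq_prob (flip_law a) u (g2 v)"
        and ?Qy = "\<lambda>u v. seq_prob (sum_law a) v u"])
    fix u assume u: "u \<in> ?L"
    have "(\<Sum>v\<in>y ` M. seq_prob (sum_law a) v u)
        \<le> (\<Sum>v\<in>{v. set v \<subseteq> {0, 1, 2} \<and> length v = n}. seq_prob (sum_law a) v u)"
    proof (rule sum_mono2)
      show "finite {v. set v \<subseteq> {0, 1, 2::nat} \<and> length v = n}"
        by (rule finite_lists_length_eq) simp
      show "y ` M \<subseteq> {v. set v \<subseteq> {0, 1, 2} \<and> length v = n}"
        using set_adder_out leny unfolding y_def by blast
      show "0 \<le> seq_prob (sum_law a) v u" for v
        by (rule less_imp_le) (rule seq_prob_pos, rule suml)
    qed
    also have "\<dots> = 1" by (rule sum_seq_prob) (use u in \<open>auto simp only: suml finite.intros\<close>)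
    finally show "(\<Sum>v\<in>y ` M. seq_prob (sum_law a) v u) \<le> 1" .
  next
    fix w u assume "u \<in> ?L"
    then show "seq_prob (flip_law a) u (g1 (f1 w)) * seq_prob (flip_law a) u (g2 (f2 w))
        * seq_prob (sum_law a) (y w) u
        = (seq_prob (post_law a) u (y w))\<^sup>2 * prod_list (map ?c (y w))"
      unfolding y_def using seq_laws_factor[of a u "g1 (f1 w)" "g2 (f2 w)", unfolded pa] p
      by (simp add: len)
  next
    fix w assume "w \<in> M"
    show "(\<Sum>u\<in>?L. seq_prob (flip_law a) u (g1 (f1 w))) \<le> 1"
      by (rule eq_refl) (rule sumL, rule flip, rule len)
    show "(\<Sum>u\<in>?L. seq_prob (flip_law a) u (g2 (f2 w))) \<le> 1"
      by (rule eq_refl) (rule sumL, rule flip, rule len)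
  qed (auto intro!: seq_prob_pos flip suml simp: y_def)
  also have "(\<Sum>w\<in>M. unif w * - log 2 (prod_list (map ?c (y w))))
      = q * - log 2 (2 * p\<^sup>2) + (real n - q) * - log 2 ((1 - p)\<^sup>2)"
    unfolding q_def by (rule sum_two_type_cost) (use M leny p in auto)
  also have "- log 2 (2 * p\<^sup>2) = - 2 * log 2 p - 1"
    using p by (simp add: log_mult log_nat_power)
  also have "- log 2 ((1 - p)\<^sup>2) = - 2 * log 2 (1 - p)"
    using p by (simp add: log_nat_power)
  finally show ?thesis .
qed

section \<open>Converse\<close>

lemma num_msgs_ge: "2 powr (real n * R) \<le> real (num_msgs n R)"
  unfolding num_msgs_def by (metis le_of_int_ceiling of_nat_0_le_iff of_nat_nat order.trans
      powr_ge_zero zero_le_ceiling less_le_trans neg_less_0_iff_less zero_less_one)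

lemma num_msgs_pos: "0 < num_msgs n R"
proof -
  have "(0::real) < 2 powr (real n * R)" by simp
  then have "0 < real (num_msgs n R)" using num_msgs_ge[of n R] by linarith
  then show ?thesis by simp
qed

lemma le_if_approx_le:
  fixes R V :: real
  assumes R: "0 \<le> R" and approx: "\<And>\<epsilon>. 0 < \<epsilon> \<Longrightarrow> \<epsilon> \<le> 1/2 \<Longrightarrow> (1 - 2 * \<epsilon>) * R \<le> V"
  shows "R \<le> V"
proof (rule field_le_epsilon)
  fix e :: real assume e: "0 < e"
  \<comment> \<open>Chosen so that \<open>2 * \<epsilon> * R \<le> e\<close>; the denominator has
    \<open>R + 1\<close> so that \<open>R = 0\<close> is covered.\<close>
  define \<epsilon> where "\<epsilon> = min (1/2) (e / (2 * (R + 1)))"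
  have pos: "0 < \<epsilon>" "\<epsilon> \<le> 1/2" unfolding \<epsilon>_def using R e by (simp, intro min.cobounded1)
  have "2 * \<epsilon> * R \<le> 2 * (e / (2 * (R + 1))) * R"
    using R by (intro mult_right_mono mult_left_mono) (auto simp: \<epsilon>_def)
  also have "\<dots> = e * (R / (R + 1))" using R by (simp add: field_simps)
  also have "\<dots> \<le> e * 1" using R e by (intro mult_left_mono) (auto simp: field_simps)
  finally have "2 * \<epsilon> * R \<le> e" by simp
  then show "R \<le> V + e" using approx[OF pos] by (simp add: algebra_simps)
qed

text \<open>By the Fano bound, the output entropy is at least
  \<open>(1 - 2 * \<epsilon>) * n * R\<close>. An upper bound linear in \<open>n\<close> on that
  entropy therefore caps the rate as \<open>\<epsilon>\<close> tends to 0.\<close>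

lemma achievable_le_if_entropy_le:
  assumes ach: "diamond_achievable C1 C2 R"
    and bound: "\<And>n (M :: nat set) (f1 :: nat \<Rightarrow> nat) (f2 :: nat \<Rightarrow> nat) g1 g2. n > 0 \<Longrightarrow> finite M \<Longrightarrow> M \<noteq> {}
      \<Longrightarrow> ent M (\<lambda>_. 1 / real (card M)) f1 \<le> real n * C1
      \<Longrightarrow> ent M (\<lambda>_. 1 / real (card M)) f2 \<le> real n * C2
      \<Longrightarrow> (\<And>v. length (g1 v) = n) \<Longrightarrow> (\<And>v. length (g2 v) = n)
      \<Longrightarrow> ent M (\<lambda>_. 1 / real (card M)) (\<lambda>w. adder_out (g1 (f1 w)) (g2 (f2 w))) \<le> real n * V"
  shows "R \<le> V"
proof (rule le_if_approx_le)
  show "0 \<le> R" using ach by (simp add: diamond_achievable_def)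
  fix \<epsilon> :: real assume eps: "0 < \<epsilon>" "\<epsilon> \<le> 1/2"
  obtain n f1 f2 g1 g2 d where n: "n > 0"
    and H: "entropy_unif {1..num_msgs n R} f1 \<le> real n * C1"
      "entropy_unif {1..num_msgs n R} f2 \<le> real n * C2"
    and len: "\<And>v. length (g1 v) = n" "\<And>v. length (g2 v) = n"
    and err: "code_error n R f1 f2 g1 g2 d \<le> \<epsilon>"
    using ach eps unfolding diamond_achievable_def by metis
  define M where "M = {1..num_msgs n R}"
  define y where "y = (\<lambda>w. adder_out (g1 (f1 w)) (g2 (f2 w)))"
  have M: "finite M" "M \<noteq> {}" "card M = num_msgs n R" using num_msgs_pos[of n R] by (auto simp: M_def)
  have "real (card {w\<in>M. d (y w) \<noteq> w}) \<le> \<epsilon> * real (card M)"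
    using err num_msgs_pos[of n R] unfolding code_error_def M(3) M_def y_def by (simp add: field_simps)
  then have fano: "(1 - 2 * \<epsilon>) * log 2 (real (card M)) \<le> ent M (\<lambda>_. 1 / real (card M)) y"
    by (rule fano_uniform[OF M(1,2)])
  have "real n * R = log 2 (2 powr (real n * R))" by simp
  also have "\<dots> \<le> log 2 (real (card M))"
    unfolding M(3) using num_msgs_ge[of n R] by (intro log_mono) auto
  finally have "(1 - 2 * \<epsilon>) * (real n * R) \<le> (1 - 2 * \<epsilon>) * log 2 (real (card M))"
    using eps by (intro mult_left_mono) auto
  also note fano
  also have "ent M (\<lambda>_. 1 / real (card M)) y \<le> real n * V"
    unfolding y_def
    using H unfolding M_def[symmetric] entropy_unif_eq_ent[OF M(1)] by (intro bound[OF n M(1,2) _ _ len])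
  finally have "real n * ((1 - 2 * \<epsilon>) * R) \<le> real n * V" by (simp add: algebra_simps)
  then show "(1 - 2 * \<epsilon>) * R \<le> V" using n by simp
qed

lemma achievable_le_sum:
  assumes "diamond_achievable C1 C2 R"
  shows "R \<le> C1 + C2"
  using assms
proof (rule achievable_le_if_entropy_le)
  fix n :: nat and M :: "nat set" and f1 f2 :: "nat \<Rightarrow> nat" and g1 g2 :: "nat \<Rightarrow> bool list"
  let ?m = "\<lambda>_::nat. 1 / real (card M)"
  assume M: "finite M" "M \<noteq> {}" and H: "ent M ?m f1 \<le> real n * C1" "ent M ?m f2 \<le> real n * C2"
  have "ent M ?m (\<lambda>w. adder_out (g1 (f1 w)) (g2 (f2 w))) \<le> ent M ?m (\<lambda>w. (f1 w, f2 w))"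
    by (rule ent_uniform_mono[OF M(1)]) auto
  also have "\<dots> \<le> ent M ?m f1 + ent M ?m f2"
    by (rule finite_weights.ent_subadditive[OF finite_weights_uniform[OF M]])
  also have "\<dots> \<le> real n * (C1 + C2)" using H by (simp add: algebra_simps)
  finally show "ent M ?m (\<lambda>w. adder_out (g1 (f1 w)) (g2 (f2 w))) \<le> real n * (C1 + C2)" .
qed

text \<open>Here \<open>x\<close> is the expected fraction of output letters equal to 1. It is
  unknown but common to both affine bounds on the output entropy, so only their minimum has to be
  controlled.\<close>

lemma achievable_le_tangent_bound:
  assumes ach: "diamond_achievable C C R" and p: "0 < p" "p \<le> 1/2"
    and V: "\<And>x. 0 \<le> x \<Longrightarrow> x \<le> 1 \<Longrightarrow> min (x * - log 2 p + (1 - x) * (1 - log 2 (1 - p)))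
      (C + x * (- log 2 p - 1/2) + (1 - x) * - log 2 (1 - p)) \<le> V"
  shows "R \<le> V"
  using ach
proof (rule achievable_le_if_entropy_le)
  fix n :: nat and M :: "nat set" and f1 f2 :: "nat \<Rightarrow> nat" and g1 g2 :: "nat \<Rightarrow> bool list"
  let ?m = "\<lambda>_::nat. 1 / real (card M)"
  assume n: "n > 0" and M: "finite M" "M \<noteq> {}"
    and H: "ent M ?m f1 \<le> real n * C" "ent M ?m f2 \<le> real n * C"
    and len: "\<And>v. length (g1 v) = n" "\<And>v. length (g2 v) = n"
  define y where "y = (\<lambda>w. adder_out (g1 (f1 w)) (g2 (f2 w)))"
  define q where "q = (\<Sum>w\<in>M. 1 / real (card M) * real (count_list (y w) 1))"
  have leny: "length (y w) = n" for w by (simp add: y_def len)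
  have cm: "0 < real (card M)" using M by (simp add: card_gt_0_iff)
  have "count_list (y w) 1 \<le> n" for w using count_le_length[of "y w" 1] by (simp only: leny)
  then have "q \<le> (\<Sum>w\<in>M. 1 / real (card M) * real n)"
    unfolding q_def by (intro sum_mono mult_left_mono) auto
  then have q: "0 \<le> q" "q \<le> real n" using cm by (auto simp: q_def intro!: sum_nonneg)
  have 1: "ent M ?m y \<le> q * - log 2 p + (real n - q) * (1 - log 2 (1 - p))"
    unfolding q_def using set_adder_out leny p
    by (intro entropy_adder_output_le M) (auto simp: y_def)
  have "ent M ?m y \<le> ent M ?m (\<lambda>w. (f1 w, f2 w))"
    by (rule ent_uniform_mono[OF M(1)]) (auto simp: y_def)
  \<comment> \<open>The output is a function of the pair of descriptions, so the bound on the sum of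
    both entropies can be halved.\<close>
  then have "2 * ent M ?m y \<le> ent M ?m (\<lambda>w. (f1 w, f2 w)) + ent M ?m y" by simp
  also have "\<dots> \<le> ent M ?m f1 + ent M ?m f2
      + (q * (- 2 * log 2 p - 1) + (real n - q) * (- 2 * log 2 (1 - p)))"
    unfolding q_def y_def by (rule entropy_diamond_le[OF M len p])
  finally have 2: "ent M ?m y \<le> real n * C + q * (- log 2 p - 1/2) + (real n - q) * - log 2 (1 - p)"
    using H by (simp add: algebra_simps)
  define x where "x = q / real n"
  have x: "0 \<le> x" "x \<le> 1" and qx: "q = real n * x" using q n by (auto simp: x_def)
  have "ent M ?m y \<le> real n * (x * - log 2 p + (1 - x) * (1 - log 2 (1 - p)))"
    using 1 unfolding qx by (simp add: algebra_simps)
  moreover have "ent M ?m y \<le> real n * (C + x * (- log 2 p - 1/2) + (1 - x) * - log 2 (1 - p))"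
    using 2 unfolding qx by (simp add: algebra_simps)
  ultimately have "ent M ?m y \<le> real n * min (x * - log 2 p + (1 - x) * (1 - log 2 (1 - p)))
      (C + x * (- log 2 p - 1/2) + (1 - x) * - log 2 (1 - p))"
    by (simp add: min_def)
  also have "\<dots> \<le> real n * V" using V[OF x] by (intro mult_left_mono) auto
  finally show "ent M ?m (\<lambda>w. adder_out (g1 (f1 w)) (g2 (f2 w))) \<le> real n * V" unfolding y_def .
qed

section \<open>Codes from sumsets\<close>

text \<open>Cross entropy against the uniform law on the image.\<close>

lemma entropy_unif_le_log_card:
  assumes M: "finite M" "M \<noteq> {}"
  shows "entropy_unif M f \<le> log 2 (real (card (f ` M)))"
proof -
  interpret finite_weights M "\<lambda>_. 1 / real (card M)" by (rule finite_weights_uniform[OF M])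
  have c: "0 < real (card (f ` M))" using M by (simp add: card_gt_0_iff)
  have "ent M (\<lambda>_. 1 / real (card M)) f
      \<le> (\<Sum>w\<in>M. 1 / real (card M) * - log 2 (1 / real (card (f ` M))))"
    by (rule ent_le_cross_entropy[where G = "\<lambda>_. 1 / real (card (f ` M))"]) (use c in auto)
  also have "\<dots> = log 2 (real (card (f ` M)))"
    using M c by (simp add: log_divide)
  finally show ?thesis by (simp add: entropy_unif_eq_ent[OF M(1)])
qed

abbreviation sumset :: "bool list set \<Rightarrow> bool list set \<Rightarrow> nat list set" where
  "sumset A B \<equiv> (\<lambda>(a, b). adder_out a b) ` (A \<times> B)"

text \<open>Messages name distinct sums, so decoding is exact and one blocklength serves every error
  tolerance.\<close>

lemma achievable_if_sumset:
  assumes n: "n > 0" and R: "R \<ge> 0" and fin: "finite A" "finite B"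
    and len: "\<And>a. a \<in> A \<Longrightarrow> length a = n" "\<And>b. b \<in> B \<Longrightarrow> length b = n"
    and card: "real (card A) \<le> 2 powr (real n * C1)" "real (card B) \<le> 2 powr (real n * C2)"
    and sum: "2 powr (real n * R) \<le> real (card (sumset A B))"
  shows "diamond_achievable C1 C2 R"
proof -
  define N where "N = num_msgs n R"
  have "N \<le> card (sumset A B)"
    unfolding N_def num_msgs_def nat_le_iff using sum by (simp add: ceiling_le_iff)
  then obtain T where T: "T \<subseteq> sumset A B" "card T = N" using obtain_subset_with_card_n by metis
  have finT: "finite T" by (rule finite_subset[OF T(1)]) (use fin in simp)
  have Npos: "0 < N" unfolding N_def by (rule num_msgs_pos)
  obtain e where e: "bij_betw e {1..N} T"
    using finite_same_card_bij[of "{1..N}" T] finT T(2) by auto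
  have "\<exists>p. fst p \<in> A \<and> snd p \<in> B \<and> e w = adder_out (fst p) (snd p)" if "w \<in> {1..N}" for w
  proof -
    have "e w \<in> sumset A B" using bij_betwE[OF e] that T(1) by blast
    then show ?thesis by force
  qed
  then obtain s where s: "\<And>w. w \<in> {1..N} \<Longrightarrow>
      fst (s w) \<in> A \<and> snd (s w) \<in> B \<and> e w = adder_out (fst (s w)) (snd (s w))"
    by metis
  obtain hA :: "bool list \<Rightarrow> nat" where hA: "inj_on hA A"
    using finite_imp_inj_to_nat_seg[OF fin(1)] by metis
  obtain hB :: "bool list \<Rightarrow> nat" where hB: "inj_on hB B"
    using finite_imp_inj_to_nat_seg[OF fin(2)] by metis
  define f1 where "f1 = (\<lambda>w. hA (fst (s w)))"
  define f2 where "f2 = (\<lambda>w. hB (snd (s w)))"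
  \<comment> \<open>Relays must emit a word of length \<open>n\<close> on every natural number,
    hence the default word off the code range.\<close>
  define g1 where "g1 = (\<lambda>v. if v \<in> hA ` A then inv_into A hA v else replicate n False)"
  define g2 where "g2 = (\<lambda>v. if v \<in> hB ` B then inv_into B hB v else replicate n False)"
  have len_g: "length (g1 v) = n" "length (g2 v) = n" for v
    unfolding g1_def g2_def using len by (auto simp: inv_into_into)
  have gf: "g1 (f1 w) = fst (s w)" "g2 (f2 w) = snd (s w)" if "w \<in> {1..N}" for w
    using s[OF that] hA hB by (auto simp: g1_def g2_def f1_def f2_def)
  define d where "d = inv_into {1..N} e"
  have correct: "d (adder_out (g1 (f1 w)) (g2 (f2 w))) = w" if "w \<in> {1..N}" for w
    using e that s[OF that] gf[OF that] by (metis bij_betw_imp_inj_on d_def inv_into_f_f)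
  have "{w\<in>{1..N}. d (adder_out (g1 (f1 w)) (g2 (f2 w))) \<noteq> w} = {}" using correct by auto
  then have err: "code_error n R f1 f2 g1 g2 d = 0"
    by (simp add: code_error_def N_def)
  have "entropy_unif {1..N} f1 \<le> log 2 (real (card (f1 ` {1..N})))"
    using Npos by (intro entropy_unif_le_log_card) auto
  also have "\<dots> \<le> log 2 (2 powr (real n * C1))"
  proof (rule log_mono)
    have "f1 ` {1..N} \<subseteq> hA ` A" using s by (auto simp: f1_def)
    then have "card (f1 ` {1..N}) \<le> card A"
      using fin card_image_le card_mono by (meson finite_imageI le_trans)
    then show "real (card (f1 ` {1..N})) \<le> 2 powr (real n * C1)" using card by linarith
    show "0 < real (card (f1 ` {1..N}))" using Npos by (simp add: card_gt_0_iff)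
  qed simp
  finally have H1: "entropy_unif {1..N} f1 \<le> real n * C1" by simp
  have "entropy_unif {1..N} f2 \<le> log 2 (real (card (f2 ` {1..N})))"
    using Npos by (intro entropy_unif_le_log_card) auto
  also have "\<dots> \<le> log 2 (2 powr (real n * C2))"
  proof (rule log_mono)
    have "f2 ` {1..N} \<subseteq> hB ` B" using s by (auto simp: f2_def)
    then have "card (f2 ` {1..N}) \<le> card B"
      using fin card_image_le card_mono by (meson finite_imageI le_trans)
    then show "real (card (f2 ` {1..N})) \<le> 2 powr (real n * C2)" using card by linarith
    show "0 < real (card (f2 ` {1..N}))" using Npos by (simp add: card_gt_0_iff)
  qed simp
  finally have H2: "entropy_unif {1..N} f2 \<le> real n * C2" by simp
  show ?thesis
    unfolding diamond_achievable_def
  proof (intro conjI allI impI)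
    fix \<epsilon> :: real assume "0 < \<epsilon>"
    then have "code_error n R f1 f2 g1 g2 d \<le> \<epsilon>" using err by simp
    then show "\<exists>n>0. \<exists>f1 f2 g1 g2 d. entropy_unif {1..num_msgs n R} f1 \<le> real n * C1 \<and>
        entropy_unif {1..num_msgs n R} f2 \<le> real n * C2 \<and>
        (\<forall>v. length (g1 v) = n) \<and> (\<forall>v. length (g2 v) = n) \<and> code_error n R f1 f2 g1 g2 d \<le> \<epsilon>"
      using n H1 H2 len_g unfolding N_def by blast
  qed (rule R)
qed

lemma adder_out_append:
  "length a = length b \<Longrightarrow> adder_out (a @ a') (b @ b') = adder_out a b @ adder_out a' b'"
  by (simp add: adder_out_def)

lemma adder_out_commute: "adder_out a b = adder_out b a"
  by (induction a b rule: list_induct2') (auto simp: adder_out_def add.commute)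

text \<open>Time sharing with the two relays swapping roles halfway makes the rates symmetric.\<close>
lemma achievable_if_sumset_swap:
  assumes n: "n > 0" and R: "R \<ge> 0" and fin: "finite X" "finite Y"
    and len: "\<And>a. a \<in> X \<Longrightarrow> length a = n" "\<And>b. b \<in> Y \<Longrightarrow> length b = n"
    and card: "real (card X) * real (card Y) \<le> 2 powr (2 * real n * C)"
    and sum: "2 powr (real n * R) \<le> real (card (sumset X Y))"
  shows "diamond_achievable C C R"
proof -
  define A where "A = (\<lambda>(x, y). x @ y) ` (X \<times> Y)"
  define B where "B = (\<lambda>(x, y). x @ y) ` (Y \<times> X)"
  have finAB: "finite A" "finite B" using fin by (auto simp: A_def B_def)
  have "card A \<le> card (X \<times> Y)" "card B \<le> card (Y \<times> X)"
    unfolding A_def B_def using fin by (intro card_image_le; simp)+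
  then have "card A \<le> card X * card Y" "card B \<le> card X * card Y"
    by (simp_all add: card_cartesian_product mult.commute)
  then have "real (card A) \<le> real (card X * card Y)" "real (card B) \<le> real (card X * card Y)"
    by (simp_all only: of_nat_le_iff)
  then have cardAB: "real (card A) \<le> 2 powr (real (2 * n) * C)" "real (card B) \<le> 2 powr (real (2 * n) * C)"
    using card by simp_all
  let ?S = "sumset X Y"
  have "(\<lambda>(s, t). s @ t) ` (?S \<times> ?S) \<subseteq> sumset A B"
  proof
    fix z assume "z \<in> (\<lambda>(s, t). s @ t) ` (?S \<times> ?S)"
    then obtain x y x' y' where xy: "x \<in> X" "y \<in> Y" "x' \<in> X" "y' \<in> Y"
      and z: "z = adder_out x y @ adder_out x' y'" by auto
    have "z = adder_out (x @ y') (y @ x')"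
      using xy len by (simp add: z adder_out_append adder_out_commute[of x'])
    moreover have "x @ y' \<in> A" "y @ x' \<in> B" using xy by (auto simp: A_def B_def)
    ultimately show "z \<in> sumset A B" by auto
  qed
  then have "card ((\<lambda>(s, t). s @ t) ` (?S \<times> ?S)) \<le> card (sumset A B)"
    using finAB by (intro card_mono) auto
  \<comment> \<open>All sums have length \<open>n\<close>, so a concatenation splits in only one
    way.\<close>
  moreover have "inj_on (\<lambda>(s, t). s @ t) (?S \<times> ?S)"
    using len by (auto simp: inj_on_def)
  ultimately have "card ?S * card ?S \<le> card (sumset A B)"
    by (simp add: card_image card_cartesian_product)
  then have "real (card ?S) * real (card ?S) \<le> real (card (sumset A B))"
    unfolding of_nat_mult[symmetric] by (simp only: of_nat_le_iff)
  moreover have "2 powr (real (2 * n) * R) = 2 powr (real n * R) * 2 powr (real n * R)"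
    unfolding powr_add[symmetric] by (simp add: algebra_simps)
  moreover have "2 powr (real n * R) * 2 powr (real n * R) \<le> real (card ?S) * real (card ?S)"
    using sum by (intro mult_mono) auto
  ultimately have "2 powr (real (2 * n) * R) \<le> real (card (sumset A B))" by linarith
  then show ?thesis
    by (intro achievable_if_sumset[of "2 * n" R A B]) (use n R finAB cardAB len in \<open>auto simp: A_def B_def\<close>)
qed

text \<open>Greedy selection: a uniformly random new set \<open>b\<close> has, for each \<open>D\<close>, a new trace on \<open>D\<close>
  with probability at least \<open>1 - |traces| / 2\<^sup>m\<close>.\<close>
lemma exists_family_many_traces:
  assumes "k \<le> 2 ^ m" "m \<le> n"
  shows "\<exists>\<B>\<subseteq>Pow {..<n}. card \<B> \<le> k \<and>
    real k * real (n choose m) \<le> 2 * (\<Sum>D\<in>{D. D \<subseteq> {..<n} \<and> card D = m}. real (card ((\<inter>) D ` \<B>)))"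
  using assms(1)
proof (induction k)
  case 0
  show ?case by (intro exI[of _ "{}"]) simp
next
  case (Suc k)
  let ?\<D> = "{D. D \<subseteq> {..<n} \<and> card D = m}"
  let ?P = "Pow {..<n}"
  define K where "K = real (n choose m)"
  obtain \<B> where B: "\<B> \<subseteq> ?P" "card \<B> \<le> k"
    "real k * K \<le> 2 * (\<Sum>D\<in>?\<D>. real (card ((\<inter>) D ` \<B>)))"
    using Suc unfolding K_def by auto
  define F where "F = (\<Sum>D\<in>?\<D>. real (card ((\<inter>) D ` \<B>)))"
  have finB: "finite \<B>" using B(1) by (rule finite_subset) simp
  have finD: "finite ?\<D>" by simp
  have cardD: "real (card ?\<D>) = K" unfolding K_def by (simp add: n_subsets)
  \<comment> \<open>\<open>g b\<close> counts the sets \<open>D\<close> on which \<open>b\<close>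
    would contribute a new trace.\<close>
  define g where "g = (\<lambda>b. \<Sum>D\<in>?\<D>. of_bool (D \<inter> b \<notin> (\<inter>) D ` \<B>) :: real)"
  have new: "real (card {b\<in>?P. D \<inter> b \<notin> (\<inter>) D ` \<B>}) \<ge> 2 ^ n - real (card ((\<inter>) D ` \<B>)) * 2 ^ (n - m)"
    if D: "D \<in> ?\<D>" for D
  proof -
    have Dn: "D \<subseteq> {..<n}" "card D = m" using D by auto
    \<comment> \<open>Once its trace on \<open>D\<close> is fixed, \<open>b\<close> is determined by
      its part outside \<open>D\<close>.\<close>
    have fibre: "card {b\<in>?P. D \<inter> b = z} \<le> 2 ^ (n - m)" for z
    proof -
      have "inj_on (\<lambda>b. b - D) {b\<in>?P. D \<inter> b = z}" by (auto simp: inj_on_def)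
      then have "card {b\<in>?P. D \<inter> b = z} \<le> card (Pow ({..<n} - D))"
        by (rule card_inj_on_le) auto
      also have "\<dots> = 2 ^ (n - m)"
        using Dn by (simp add: card_Pow card_Diff_subset finite_subset[OF Dn(1)])
      finally show ?thesis .
    qed
    have "?P = {b\<in>?P. D \<inter> b \<notin> (\<inter>) D ` \<B>} \<union> (\<Union>z\<in>(\<inter>) D ` \<B>. {b\<in>?P. D \<inter> b = z})" by auto
    then have "card ?P \<le> card {b\<in>?P. D \<inter> b \<notin> (\<inter>) D ` \<B>}
        + card (\<Union>z\<in>(\<inter>) D ` \<B>. {b\<in>?P. D \<inter> b = z})"
      by (metis (no_types, lifting) card_Un_le)
    also have "card (\<Union>z\<in>(\<inter>) D ` \<B>. {b\<in>?P. D \<inter> b = z}) \<le> (\<Sum>z\<in>(\<inter>) D ` \<B>. card {b\<in>?P. D \<inter> b = z})"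
      using finB by (intro card_UN_le) simp
    also have "\<dots> \<le> (\<Sum>z\<in>(\<inter>) D ` \<B>. 2 ^ (n - m))" by (intro sum_mono fibre)
    finally have "2 ^ n \<le> card {b\<in>?P. D \<inter> b \<notin> (\<inter>) D ` \<B>} + card ((\<inter>) D ` \<B>) * 2 ^ (n - m)"
      by (simp add: card_Pow)
    then have "real (2 ^ n) \<le> real (card {b\<in>?P. D \<inter> b \<notin> (\<inter>) D ` \<B>} + card ((\<inter>) D ` \<B>) * 2 ^ (n - m))"
      by (simp only: of_nat_le_iff)
    then show ?thesis by simp
  qed
  have "(\<Sum>b\<in>?P. g b) = (\<Sum>D\<in>?\<D>. \<Sum>b\<in>?P. of_bool (D \<inter> b \<notin> (\<inter>) D ` \<B>))"
    unfolding g_def by (rule sum.swap)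
  also have "\<dots> = (\<Sum>D\<in>?\<D>. real (card {b\<in>?P. D \<inter> b \<notin> (\<inter>) D ` \<B>}))"
    by (simp add: sum_of_bool_eq Int_def)
  also have "\<dots> \<ge> (\<Sum>D\<in>?\<D>. 2 ^ n - real (card ((\<inter>) D ` \<B>)) * 2 ^ (n - m))"
    by (intro sum_mono new)
  also have "(\<Sum>D\<in>?\<D>. 2 ^ n - real (card ((\<inter>) D ` \<B>)) * 2 ^ (n - m)) = K * 2 ^ n - F * 2 ^ (n - m)"
    by (simp add: sum_subtractf F_def sum_distrib_right cardD)
  also have "\<dots> = 2 ^ n * (K - F / 2 ^ m)"
    using assms(2) by (simp add: power_diff field_simps)
  finally have avg: "2 ^ n * (K - F / 2 ^ m) \<le> (\<Sum>b\<in>?P. g b)" .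
  have "\<exists>b\<in>?P. K - F / 2 ^ m \<le> g b"
  proof (rule ccontr)
    assume "\<not> ?thesis"
    then have "(\<Sum>b\<in>?P. g b) < (\<Sum>b\<in>?P. K - F / 2 ^ m)"
      by (intro sum_strict_mono) (auto simp: not_le)
    then show False using avg by (simp add: card_Pow)
  qed
  then obtain b where b: "b \<in> ?P" "K - F / 2 ^ m \<le> g b" by blast
  have "real (card ((\<inter>) D ` insert b \<B>)) = real (card ((\<inter>) D ` \<B>)) + of_bool (D \<inter> b \<notin> (\<inter>) D ` \<B>)" for D
    using finB by (simp add: card_insert_if insert_absorb)
  then have F': "(\<Sum>D\<in>?\<D>. real (card ((\<inter>) D ` insert b \<B>))) = F + g b"
    by (simp add: F_def g_def sum.distrib)
  \<comment> \<open>With \<open>F\<close> at least \<open>k * K / 2\<close> and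
    \<open>k \<le> 2 ^ m\<close>, shrinking \<open>F\<close> by the factor
    \<open>1 - 1 / 2 ^ m\<close> costs at most \<open>K / 2\<close> of the gain \<open>K\<close>, so
    each step nets at least \<open>K / 2\<close>.\<close>
  have "F + g b \<ge> F * (1 - 1 / 2 ^ m) + K" using b(2) by (simp add: field_simps)
  moreover have "F * (1 - 1 / 2 ^ m) \<ge> real k * K / 2 * (1 - 1 / 2 ^ m)"
    using B(3) by (intro mult_right_mono) (auto simp: F_def field_simps)
  moreover have "real k * K / 2 * (1 / 2 ^ m) \<le> K / 2"
  proof -
    have "real k \<le> 2 ^ m" using Suc.prems by (metis Suc_leD of_nat_le_iff of_nat_numeral of_nat_power)
    then have "real k / 2 ^ m * (K / 2) \<le> 1 * (K / 2)"
      by (intro mult_right_mono) (auto simp: K_def)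
    then show ?thesis by (simp add: field_simps)
  qed
  ultimately have "F + g b \<ge> (real k + 1) * K / 2" by (simp add: algebra_simps add_divide_distrib)
  then have "real (Suc k) * K \<le> 2 * (\<Sum>D\<in>?\<D>. real (card ((\<inter>) D ` insert b \<B>)))"
    unfolding F' by (simp add: algebra_simps)
  moreover have "card (insert b \<B>) \<le> Suc k" using B(2) finB by (simp add: card_insert_if)
  moreover have "insert b \<B> \<subseteq> ?P" using B(1) b(1) by simp
  ultimately show ?case unfolding K_def by blast
qed

text \<open>With all words available to one relay, it can agree with \<open>b\<close> on exactly any
  prescribed \<open>D\<close>. The sum then reveals both \<open>D\<close> and the trace of
  \<open>b\<close> on \<open>D\<close>, so distinct pairs of these give distinct sums.\<close>

lemma exists_large_sumset_with_full:
  assumes "k \<le> 2 ^ m" "m \<le> n"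
  shows "\<exists>B. (\<forall>b\<in>B. length b = n) \<and> finite B \<and> card B \<le> k
    \<and> real k * real (n choose m) \<le> 2 * real (card (sumset {x. length x = n} B))"
proof -
  let ?\<D> = "{D. D \<subseteq> {..<n} \<and> card D = m}"
  obtain \<B> where B: "\<B> \<subseteq> Pow {..<n}" "card \<B> \<le> k"
    "real k * real (n choose m) \<le> 2 * (\<Sum>D\<in>?\<D>. real (card ((\<inter>) D ` \<B>)))"
    using exists_family_many_traces[OF assms] by blast
  have finB: "finite \<B>" using B(1) by (rule finite_subset) simp
  define enc where "enc = (\<lambda>b. map (\<lambda>i. i \<in> b) [0..<n])"
  let ?X = "{x :: bool list. length x = n}"
  let ?S = "sumset ?X (enc ` \<B>)"
  define out where "out = (\<lambda>(D, z). map (\<lambda>i. if i \<in> D then 2 * of_bool (i \<in> z) else 1 :: nat) [0..<n])"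
  have finX: "finite ?X" using finite_lists_length_eq[of "UNIV :: bool set" n] by simp
  have "out ` (SIGMA D:?\<D>. (\<inter>) D ` \<B>) \<subseteq> ?S"
  proof
    fix y assume "y \<in> out ` (SIGMA D:?\<D>. (\<inter>) D ` \<B>)"
    then obtain D b where Db: "b \<in> \<B>" "y = out (D, D \<inter> b)" by auto
    \<comment> \<open>The free relay copies \<open>b\<close> on \<open>D\<close> and complements it
      elsewhere, forcing the letter 1 outside \<open>D\<close>.\<close>
    have "y = adder_out (map (\<lambda>i. (i \<in> b) = (i \<in> D)) [0..<n]) (enc b)"
      unfolding Db(2) out_def enc_def adder_out_def by (auto simp: map2_map_map)
    then show "y \<in> ?S" using Db(1)
      by (auto intro!: image_eqI[where x = "(map (\<lambda>i. (i \<in> b) = (i \<in> D)) [0..<n], enc b)"])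
  qed
  then have "card (out ` (SIGMA D:?\<D>. (\<inter>) D ` \<B>)) \<le> card ?S"
    using finX finB by (intro card_mono) auto
  \<comment> \<open>Decoding: \<open>D\<close> is where the sum differs from 1, the trace is where
    it equals 2.\<close>
  moreover have "inj_on out (SIGMA D:?\<D>. (\<inter>) D ` \<B>)"
  proof (rule inj_on_inverseI[where g = "\<lambda>y. ({i. i < n \<and> y ! i \<noteq> 1}, {i. i < n \<and> y ! i = 2})"])
    fix Dz assume "Dz \<in> (SIGMA D:?\<D>. (\<inter>) D ` \<B>)"
    then obtain D b where Db: "D \<subseteq> {..<n}" "Dz = (D, D \<inter> b)" by auto
    show "({i. i < n \<and> out Dz ! i \<noteq> 1}, {i. i < n \<and> out Dz ! i = 2}) = Dz"
      using Db(1) unfolding Db(2) out_def by (auto split: if_splits simp: of_bool_def)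
  qed
  ultimately have "card (SIGMA D:?\<D>. (\<inter>) D ` \<B>) \<le> card ?S" by (simp add: card_image)
  moreover have "card (SIGMA D:?\<D>. (\<inter>) D ` \<B>) = (\<Sum>D\<in>?\<D>. card ((\<inter>) D ` \<B>))"
    using finB by (intro card_SigmaI) auto
  ultimately have "real (\<Sum>D\<in>?\<D>. card ((\<inter>) D ` \<B>)) \<le> real (card ?S)"
    by (simp only: of_nat_le_iff)
  then have "real k * real (n choose m) \<le> 2 * real (card ?S)" using B(3) by simp
  moreover have "card (enc ` \<B>) \<le> k" using card_image_le[OF finB, of enc] B(2) by linarith
  ultimately show ?thesis
    using finB by (intro exI[of _ "enc ` \<B>"]) (auto simp: enc_def)
qed

text \<open>The \<open>m\<close>-th term of the binomial expansion of \<open>(m + (n - m))\<^sup>n\<close> is the largest one.\<close>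
lemma binomial_max_term:
  assumes m: "0 < m" "m < n"
  shows "n ^ n \<le> (n + 1) * ((n choose m) * m ^ m * (n - m) ^ (n - m))"
proof -
  define d where "d = n - m"
  have d: "0 < d" "n = m + d" using m by (auto simp: d_def)
  define a where "a = (\<lambda>j. (n choose j) * m ^ j * d ^ (n - j))"
  \<comment> \<open>Consecutive terms have ratio \<open>(n - j) * m / (Suc j * d)\<close>, at least
    1 for \<open>j < m\<close> and at most 1 from \<open>m\<close> on. The cross-multiplied form
    stays in the naturals.\<close>
  have ratio: "(Suc j * d) * a (Suc j) = ((n - j) * m) * a j" if "j < n" for j
  proof -
    have "Suc j * (n choose Suc j) = (n - j) * (n choose j)"
      by (metis binomial_absorb_comp binomial_absorption)
    moreover have "d ^ (n - j) = d * d ^ (n - Suc j)"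
      using that by (metis Suc_diff_Suc power_Suc)
    moreover have "(Suc j * d) * a (Suc j) = (Suc j * (n choose Suc j)) * m ^ Suc j * (d * d ^ (n - Suc j))"
      unfolding a_def by (simp only: ac_simps)
    ultimately have "(Suc j * d) * a (Suc j) = ((n - j) * (n choose j)) * m ^ Suc j * d ^ (n - j)" by simp
    then show ?thesis unfolding a_def by (simp only: power_Suc ac_simps)
  qed
  have up: "a j \<le> a (Suc j)" if j: "j < m" for j
  proof -
    obtain i where i: "m = Suc j + i" using less_imp_Suc_add[OF j] by auto
    have "(Suc j * d) * a j \<le> ((n - j) * m) * a j"
      by (intro mult_right_mono) (auto simp: i d(2) algebra_simps)
    also have "\<dots> = (Suc j * d) * a (Suc j)" using ratio[of j] j m by simp
    finally show ?thesis using d by simp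
  qed
  have down: "a (Suc j) \<le> a j" if j: "m \<le> j" "j < n" for j
  proof -
    obtain i where i: "j = m + i" using le_Suc_ex[OF j(1)] by auto
    obtain l where l: "n = Suc j + l" using less_imp_Suc_add[OF j(2)] by auto
    have dl: "d = Suc i + l" using l i d by simp
    have "(Suc j * d) * a (Suc j) = ((n - j) * m) * a j" using ratio j by simp
    also have "\<dots> \<le> (Suc j * d) * a j"
    proof (intro mult_right_mono)
      have "n - j = Suc l" using l by simp
      moreover have "Suc l * m \<le> Suc j * d" 
        unfolding i dl by (subst mult.commute) (intro mult_mono; simp)
      ultimately show "(n - j) * m \<le> Suc j * d" by simp
    qed simp
    finally show ?thesis using d by simp
  qed
  have max: "a j \<le> a m" if "j \<le> n" for j
  proof (cases "j \<le> m")
    case True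
    then show ?thesis
      by (induction rule: inc_induct) (auto intro: order.trans up)
  next
    case False
    then have "m \<le> j" by simp
    then show ?thesis using that
      by (induction rule: dec_induct) (auto intro: order.trans[OF down])
  qed
  have "n ^ n = (\<Sum>j\<le>n. a j)"
    using binomial_ring[of m d n] d(2) unfolding a_def by simp
  also have "\<dots> \<le> (\<Sum>j\<le>n. a m)" by (intro sum_mono max) simp
  finally show ?thesis by (simp add: a_def d_def)
qed

text \<open>The left side equals \<open>n ^ n / (m ^ m * d ^ d)\<close> with
  \<open>d = n - m\<close>, so this is \<open>binomial_max_term\<close> rearranged.\<close>

lemma two_powr_h2_le_binomial:
  assumes m: "0 < m" "m < n"
  shows "2 powr (real n * h2 (real m / real n)) \<le> real (n + 1) * real (n choose m)"
proof -
  define d where "d = n - m"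
  have d: "0 < d" "real d = real n - real m" using m by (auto simp: d_def)
  have n: "0 < n" using m by simp
  have self_powr: "2 powr (real x * log 2 (real x)) = real x ^ x" if "0 < x" for x
  proof -
    have "2 powr (real x * log 2 (real x)) = (2 powr log 2 (real x)) powr real x"
      by (simp add: powr_powr mult.commute)
    also have "\<dots> = real x ^ x" using that by (simp add: powr_realpow)
    finally show ?thesis .
  qed
  have "1 - real m / real n = real d / real n" using d n by (simp add: field_simps)
  then have "real n * h2 (real m / real n)
      = real n * log 2 (real n) - real m * log 2 (real m) - real d * log 2 (real d)"
    using m d n unfolding h2_def by (simp add: log_divide d(2) field_simps)
  then have "2 powr (real n * h2 (real m / real n)) * (real m ^ m * real d ^ d)
      = 2 powr (real n * log 2 (real n) - real m * log 2 (real m) - real d * log 2 (real d))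
        * (2 powr (real m * log 2 (real m)) * 2 powr (real d * log 2 (real d)))"
    using m d(1) by (simp only: self_powr)
  also have "\<dots> = 2 powr (real n * log 2 (real n))"
    by (simp add: powr_add[symmetric])
  also have "\<dots> = real (n ^ n)"
    using n by (simp only: self_powr of_nat_power)
  also have "\<dots> \<le> real ((n + 1) * ((n choose m) * m ^ m * d ^ d))"
    unfolding of_nat_le_iff d_def by (rule binomial_max_term[OF m])
  also have "\<dots> = real (n + 1) * real (n choose m) * (real m ^ m * real d ^ d)"
    by (simp only: of_nat_mult of_nat_power mult.assoc)
  finally show ?thesis by (rule mult_right_le_imp_le) (use m d in simp)
qed

section \<open>Achievable rates\<close>

lemma isCont_h2: "0 < x \<Longrightarrow> x < 1 \<Longrightarrow> isCont h2 x"
  unfolding h2_def[abs_def] log_def by (intro continuous_intros) auto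

lemma h2_flip: "h2 (1 - p) = h2 p"
  by (simp add: h2_def algebra_simps)

text \<open>About \<open>n * (1 - p)\<close> coordinates carry traces of a set of about
  \<open>2 powr (n * r)\<close> words. There are about \<open>2 powr (n * (h2 p + r))\<close> sums;
  \<open>r \<le> 1 - p\<close> allows that many traces, and \<open>r \<le> 2 * C - 1\<close> meets
  the link budget shared by both relays.\<close>

lemma achievable_superposition:
  assumes C: "1/2 \<le> C" and p: "0 < p" "p < 1"
    and R: "0 \<le> R" "R < h2 p + min (1 - p) (2 * C - 1)"
  shows "diamond_achievable C C R"
proof -
  define r where "r = min (1 - p) (2 * C - 1)"
  define m where "m = (\<lambda>n. nat \<lfloor>real n * (1 - p)\<rfloor>)"
  have r: "0 \<le> r" "r \<le> 1 - p" "r \<le> 2 * C - 1" using C p by (auto simp: r_def)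
  have m: "real (m n) \<le> real n * (1 - p)" "real n * (1 - p) - 1 \<le> real (m n)" for n
    unfolding m_def using p by (auto intro: of_nat_floor)
  have lim_m: "(\<lambda>n. real (m n) / real n) \<longlonglongrightarrow> 1 - p"
  proof (rule tendsto_sandwich)
    show "\<forall>\<^sub>F n in sequentially. (1 - p) - 1 / real n \<le> real (m n) / real n"
      using eventually_gt_at_top[of 0]
    proof eventually_elim
      case (elim n)
      have "(real n * (1 - p) - 1) / real n \<le> real (m n) / real n"
        using m(2)[of n] by (rule divide_right_mono) simp
      then show ?case using elim by (simp add: diff_divide_distrib)
    qed
    show "\<forall>\<^sub>F n in sequentially. real (m n) / real n \<le> 1 - p"
      using eventually_gt_at_top[of 0] by eventually_elim (use m in \<open>auto simp: field_simps\<close>)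
    show "(\<lambda>n. (1 - p) - 1 / real n) \<longlonglongrightarrow> 1 - p"
      using tendsto_diff[OF tendsto_const lim_1_over_n] by simp
  qed simp
  have "(\<lambda>n. h2 (real (m n) / real n)) \<longlonglongrightarrow> h2 p"
    using isCont_tendsto_compose[OF isCont_h2 lim_m] p by (simp add: h2_flip)
  \<comment> \<open>The losses are one bit for rounding down \<open>k\<close>, one bit for the
    factor 2 in the sumset bound, and \<open>log 2 (n + 1)\<close> from the binomial
    estimate.\<close>
  moreover have "(\<lambda>n. r - 2 / real n - log 2 (real (n + 1)) / real n) \<longlonglongrightarrow> r"
  proof -
    have "(\<lambda>n. ln (real (n + 1)) / real (n + 1)) \<longlonglongrightarrow> 0"
      using filterlim_compose[OF ln_x_over_x_tendsto_0 filterlim_compose[OF filterlim_real_sequentially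
            filterlim_add_const_nat_at_top[of 1]]] .
    moreover have "(\<lambda>n. 1 + 1 / real n) \<longlonglongrightarrow> 1 + 0"
      by (intro tendsto_intros lim_1_over_n)
    ultimately have "(\<lambda>n. ln (real (n + 1)) / real (n + 1) * (1 + 1 / real n) / ln 2) \<longlonglongrightarrow> 0 * (1 + 0) / ln 2"
      by (intro tendsto_intros) auto
    moreover have "\<forall>\<^sub>F n in sequentially. ln (real (n + 1)) / real (n + 1) * (1 + 1 / real n) / ln 2
        = log 2 (real (n + 1)) / real n"
      using eventually_gt_at_top[of 0]
    proof eventually_elim
      case (elim n)
      then have "1 + 1 / real n = real (n + 1) / real n" by (simp add: field_simps)
      then show ?case by (simp add: log_def)
    qed
    ultimately have "(\<lambda>n. log 2 (real (n + 1)) / real n) \<longlonglongrightarrow> 0"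
      by (auto elim: Lim_transform_eventually)
    moreover have "(\<lambda>n. r - 2 * (1 / real n)) \<longlonglongrightarrow> r - 2 * 0"
      by (intro tendsto_intros lim_1_over_n)
    ultimately show ?thesis using tendsto_diff by fastforce
  qed
  ultimately have "(\<lambda>n. h2 (real (m n) / real n) + (r - 2 / real n - log 2 (real (n + 1)) / real n))
      \<longlonglongrightarrow> h2 p + r"
    by (rule tendsto_add)
  then have "\<forall>\<^sub>F n in sequentially.
      R < h2 (real (m n) / real n) + (r - 2 / real n - log 2 (real (n + 1)) / real n)"
    using R(2) unfolding r_def by (rule order_tendstoD)
  moreover have "\<forall>\<^sub>F n in sequentially. 0 < real (m n) / real n"
    using lim_m by (rule order_tendstoD) (use p in simp)
  ultimately have "\<forall>\<^sub>F n in sequentially. R < h2 (real (m n) / real n)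
      + (r - 2 / real n - log 2 (real (n + 1)) / real n) \<and> 0 < real (m n) / real n"
    by (rule eventually_conj)
  then obtain n where n: "R < h2 (real (m n) / real n)
      + (r - 2 / real n - log 2 (real (n + 1)) / real n)" "0 < real (m n) / real n"
    unfolding eventually_sequentially by blast
  have n0: "0 < n" "0 < m n" using n(2) by (cases "n = 0"; cases "m n = 0"; simp)+
  have "real n * (1 - p) < real n * 1" using p n0 by (intro mult_strict_left_mono) auto
  then have mn: "m n < n" using m(1)[of n] by linarith
  define k where "k = nat \<lfloor>real n * r\<rfloor>"
  have k: "real k \<le> real n * r" "real n * r - 1 \<le> real k"
    unfolding k_def using r by (auto intro: of_nat_floor)
  have "k \<le> m n" unfolding k_def m_def using r by (intro nat_mono floor_mono mult_left_mono) auto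
  then have "2 ^ k \<le> (2::nat) ^ m n" by (intro power_increasing) auto
  then obtain B where B: "\<And>b. b \<in> B \<Longrightarrow> length b = n" "finite B" "card B \<le> 2 ^ k"
    "real (2 ^ k) * real (n choose m n) \<le> 2 * real (card (sumset {x. length x = n} B))"
    using exists_large_sumset_with_full[of "2 ^ k" "m n" n] mn by auto
  let ?X = "{x :: bool list. length x = n}"
  have X: "finite ?X" "card ?X = 2 ^ n"
    using finite_lists_length_eq[of "UNIV :: bool set" n] card_lists_length_eq[of "UNIV :: bool set" n]
    by auto
  show ?thesis
  proof (rule achievable_if_sumset_swap[OF n0(1) R(1) X(1) B(2) _ B(1)])
    have "real (card ?X) * real (card B) \<le> 2 ^ n * 2 ^ k"
      using B(3) unfolding X(2) by (intro mult_mono) (auto simp flip: of_nat_power simp: le_nat_iff)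
    also have "\<dots> = 2 powr (real n + real k)" by (simp add: powr_add powr_realpow)
    also have "\<dots> \<le> 2 powr (2 * real n * C)"
    proof (rule powr_mono)
      have "real n * r \<le> real n * (2 * C - 1)" using r by (intro mult_left_mono) auto
      then show "real n + real k \<le> 2 * real n * C" using k(1) by (simp add: algebra_simps)
    qed simp
    finally show "real (card ?X) * real (card B) \<le> 2 powr (2 * real n * C)" .
    have "real n * R \<le> real n * (h2 (real (m n) / real n)
        + (r - 2 / real n - log 2 (real (n + 1)) / real n))"
      using n(1) by (intro mult_left_mono) auto
    also have "\<dots> = real n * h2 (real (m n) / real n) + (real n * r - 1) - 1 - log 2 (real (n + 1))"
      using n0 by (simp add: algebra_simps)
    also have "\<dots> \<le> real n * h2 (real (m n) / real n) + real k - 1 - log 2 (real (n + 1))"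
      using k(2) by simp
    finally have "2 powr (real n * R)
        \<le> 2 powr (real n * h2 (real (m n) / real n) + real k - 1 - log 2 (real (n + 1)))"
      by (intro powr_mono) auto
    also have "\<dots> = 2 powr (real n * h2 (real (m n) / real n)) / real (n + 1) * 2 ^ k / 2"
      by (simp add: powr_diff powr_add powr_realpow)
    also have "\<dots> \<le> real (n choose m n) * 2 ^ k / 2"
      using two_powr_h2_le_binomial[OF n0(2) mn]
      by (intro divide_right_mono mult_right_mono) (auto simp: field_simps)
    also have "\<dots> \<le> real (card (sumset ?X B))" using B(4) by (simp add: mult.commute)
    finally show "2 powr (real n * R) \<le> real (card (sumset ?X B))" .
  qed auto
qed

text \<open>One relay sends about \<open>2 * n * C\<close> uncoded bits, at most \<open>n\<close> of
  them because \<open>C \<le> 1/2\<close>, while the other sends zeros; the swap evens out the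
  load.\<close>

lemma achievable_low_capacity:
  assumes C: "0 \<le> C" "C \<le> 1/2" and R: "0 \<le> R" "R < 2 * C"
  shows "diamond_achievable C C R"
proof -
  \<comment> \<open>Large enough that the slack \<open>n * (2 * C - R)\<close> exceeds the bit lost
    by rounding.\<close>
  obtain n :: nat where n: "1 / (2 * C - R) < real n" using reals_Archimedean2 by blast
  have n0: "0 < n" using n R by (cases "n = 0") (auto simp: field_simps)
  have nR: "1 < real n * (2 * C - R)" using n R by (simp add: field_simps)
  define k where "k = nat \<lfloor>2 * real n * C\<rfloor>"
  have k: "real k \<le> 2 * real n * C" "2 * real n * C - 1 \<le> real k"
    unfolding k_def using C by (auto intro: of_nat_floor)
  have "2 * real n * C \<le> real n * 1" using C mult_left_mono[of "2 * C" 1 "real n"] by (simp add: ac_simps)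
  then have kn: "k \<le> n" using k(1) by linarith
  let ?z = "replicate n False"
  define X where "X = (\<lambda>x. x @ replicate (n - k) False) ` {x :: bool list. length x = k}"
  have finL: "finite {x :: bool list. length x = k}" "card {x :: bool list. length x = k} = 2 ^ k"
    using finite_lists_length_eq[of "UNIV :: bool set" k] card_lists_length_eq[of "UNIV :: bool set" k]
    by auto
  have "card X = card {x :: bool list. length x = k}"
    unfolding X_def by (intro card_image) (auto simp: inj_on_def)
  then have cX: "card X = 2 ^ k" using finL by simp
  have finX: "finite X" unfolding X_def using finL by simp
  have lenX: "length x = n" if "x \<in> X" for x using that kn by (auto simp: X_def)
  have zero: "adder_out x (replicate (length x) False) = map of_bool x" for x
    by (induction x) auto
  have "sumset X {?z} = (\<lambda>x. adder_out x ?z) ` X" by auto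
  also have "\<dots> = map of_bool ` X"
    using lenX zero by (intro image_cong refl) metis
  finally have "sumset X {?z} = map of_bool ` X" .
  moreover have "inj_on (map of_bool :: bool list \<Rightarrow> nat list) X"
    by (intro inj_on_subset[OF inj_mapI]) (auto simp: inj_def)
  ultimately have cS: "card (sumset X {?z}) = 2 ^ k" by (simp add: card_image cX)
  show ?thesis
  proof (rule achievable_if_sumset_swap[OF n0 R(1) finX _ lenX])
    have "real (card X) * real (card {?z}) = 2 powr real k" by (simp add: cX powr_realpow)
    also have "\<dots> \<le> 2 powr (2 * real n * C)" using k(1) by (intro powr_mono) auto
    finally show "real (card X) * real (card {?z}) \<le> 2 powr (2 * real n * C)" .
    have "real n * R \<le> real k" using nR k(2) by (simp add: algebra_simps)
    then have "2 powr (real n * R) \<le> 2 powr real k" by (intro powr_mono) auto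
    then show "2 powr (real n * R) \<le> real (card (sumset X {?z}))" by (simp add: cS powr_realpow)
  qed auto
qed

lemma achievable_zero:
  assumes "0 \<le> C"
  shows "diamond_achievable C C 0"
  by (rule achievable_if_sumset[where n = 1 and A = "{[False]}" and B = "{[False]}"])
    (use assms in \<open>auto simp: ge_one_powr_ge_zero\<close>)

section \<open>The capacity\<close>

text \<open>By density, rates strictly below \<open>V\<close> suffice. Rate 0 makes the set nonempty
  and dominates negative rates; \<open>upper\<close> makes it bounded, so that \<open>Sup\<close> is
  a true supremum.\<close>

lemma diamond_capacity_eqI:
  assumes "0 \<le> C" and upper: "\<And>R. diamond_achievable C C R \<Longrightarrow> R \<le> V"
    and lower: "\<And>R. 0 \<le> R \<Longrightarrow> R < V \<Longrightarrow> diamond_achievable C C R"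
  shows "diamond_capacity C C = V"
  unfolding diamond_capacity_def
proof (rule antisym)
  show "Sup {R. diamond_achievable C C R} \<le> V"
    by (rule cSup_least) (use achievable_zero[OF assms(1)] upper in auto)
  have bdd: "bdd_above {R. diamond_achievable C C R}" using upper by (intro bdd_aboveI[of _ V]) auto
  show "V \<le> Sup {R. diamond_achievable C C R}"
  proof (rule dense_le)
    fix R assume "R < V"
    show "R \<le> Sup {R. diamond_achievable C C R}"
    proof (cases "0 \<le> R")
      case True
      then show ?thesis using lower \<open>R < V\<close> bdd by (intro cSup_upper) auto
    next
      case False
      then have "R \<le> 0" by simp
      also have "0 \<le> Sup {R. diamond_achievable C C R}"
        using achievable_zero[OF assms(1)] bdd by (intro cSup_upper) auto
      finally show ?thesis .
    qed
  qed
qed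

section \<open>Tangents of the single-letter formulas\<close>

text \<open>Concavity: the right side is the tangent of \<open>h2\<close> at \<open>p\<close>. The
  bound \<open>ln t \<le> t - 1\<close> is applied to each summand, with weight 0 treated apart, and
  the two linear corrections cancel.\<close>

lemma h2_le_cross:
  assumes x: "0 \<le> x" "x \<le> 1" and p: "0 < p" "p < 1"
  shows "h2 x \<le> - x * log 2 p - (1 - x) * log 2 (1 - p)"
proof -
  have summand: "- (t * log 2 t) \<le> - (t * log 2 q) + (q - t) / ln 2" if "0 \<le> t" "0 < q" for t q :: real
  proof (cases "t = 0")
    case False
    then have t: "0 < t" using that by simp
    have "ln (q / t) \<le> q / t - 1" using t that by (intro ln_le_minus_one) simp
    then have "t * (ln q - ln t) \<le> t * (q / t - 1)" using t that by (intro mult_left_mono) (auto simp: ln_div)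
    also have "\<dots> = q - t" using t by (simp add: field_simps)
    finally have "(t * ln q - t * ln t) / ln 2 \<le> (q - t) / ln 2"
      by (intro divide_right_mono) (auto simp: algebra_simps)
    then show ?thesis by (simp add: log_def diff_divide_distrib)
  qed (use that in simp)
  have "(p - x) / ln 2 + ((1 - p) - (1 - x)) / ln 2 = 0" by (simp add: diff_divide_distrib)
  moreover have "- (x * log 2 x) \<le> - (x * log 2 p) + (p - x) / ln 2"
    "- ((1 - x) * log 2 (1 - x)) \<le> - ((1 - x) * log 2 (1 - p)) + ((1 - p) - (1 - x)) / ln 2"
    using x p by (intro summand; simp)+
  ultimately show ?thesis unfolding h2_def mult_minus_left by linarith
qed

lemma h2_half: "h2 (1/2) = 1"
  by (simp add: h2_def log_divide)

lemma h2_le_1: "0 \<le> x \<Longrightarrow> x \<le> 1 \<Longrightarrow> h2 x \<le> 1"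
  using h2_le_cross[of x "1/2"] by (simp add: log_divide)

text \<open>The slopes are \<open>s - 1\<close> and \<open>s - 1/2\<close>. The first is at most 0
  since \<open>p \<ge> 1/3\<close>, which settles \<open>x \<ge> p\<close>. The second is at least 0
  when \<open>p \<le> p1\<close>, which settles \<open>x < p\<close>, because at
  \<open>p = 2 - 2 * C\<close> both tangents take the value \<open>h2 p + 1 - p\<close>. At
  \<open>p = 1/3\<close> the first tangent is constant.\<close>

lemma min_tangents_le:
  assumes p: "1/3 \<le> p" "p \<le> 1/2" and C: "p = 1/3 \<or> p = 2 - 2 * C \<and> p \<le> p1"
  shows "min (x * - log 2 p + (1 - x) * (1 - log 2 (1 - p)))
      (C + x * (- log 2 p - 1/2) + (1 - x) * - log 2 (1 - p)) \<le> h2 p + 1 - p"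
proof -
  define s where "s = log 2 ((1 - p) / p)"
  have s: "s = log 2 (1 - p) - log 2 p" using p by (simp add: s_def log_divide)
  have "s \<le> log 2 2" unfolding s_def using p by (intro log_mono) (auto simp: field_simps)
  then have s1: "s \<le> 1" by simp
  have L1: "x * - log 2 p + (1 - x) * (1 - log 2 (1 - p)) = h2 p + 1 - p + (x - p) * (s - 1)"
    unfolding h2_def s by (simp add: algebra_simps)
  have L2: "C + x * (- log 2 p - 1/2) + (1 - x) * - log 2 (1 - p)
      = C + h2 p - p / 2 + (x - p) * (s - 1/2)"
    unfolding h2_def s by (simp add: algebra_simps diff_divide_distrib)
  consider "p = 1/3" | "p \<le> x" | "x < p" "p = 2 - 2 * C" "p \<le> p1" using C by linarith
  then show ?thesis
  proof cases
    case 1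
    then have "s = 1" unfolding s_def 1 by simp
    then show ?thesis unfolding L1 by simp
  next
    case 2
    then have "(x - p) * (s - 1) \<le> 0" using s1 by (intro mult_nonneg_nonpos) auto
    then show ?thesis unfolding L1 by (intro min.coboundedI1) simp
  next
    case 3
    \<comment> \<open>\<open>p1\<close> is the crossover at which \<open>(1 - p) / p\<close> equals
      \<open>sqrt 2\<close>, that is, \<open>s = 1/2\<close>.\<close>
    have "sqrt 2 \<le> (1 - p) / p"
    proof -
      have "p * (1 + sqrt 2) \<le> p1 * (1 + sqrt 2)" using 3 by (intro mult_right_mono) auto
      also have "\<dots> = 1" unfolding p1_def by (simp add: add_pos_nonneg less_imp_neq[symmetric])
      finally show ?thesis using p by (simp add: field_simps)
    qed
    then have "log 2 (sqrt 2) \<le> s" unfolding s_def by (intro log_mono) auto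
    then have "1/2 \<le> s" by (simp add: powr_half_sqrt[symmetric])
    then have "(x - p) * (s - 1/2) \<le> 0" using 3 by (intro mult_nonpos_nonneg) auto
    then have "C + h2 p - p / 2 + (x - p) * (s - 1/2) \<le> h2 p + 1 - p" using 3(2) by linarith
    then show ?thesis unfolding L2 by (rule min.coboundedI2)
  qed
qed

lemma p1_bounds: "1/3 \<le> p1" "p1 \<le> 1/2"
proof -
  define s where "s = sqrt 2"
  have "1 \<le> s" "s \<le> 2" by (auto simp: s_def real_le_lsqrt)
  then show "1/3 \<le> p1" "p1 \<le> 1/2" unfolding p1_def s_def[symmetric] by (auto simp: field_simps)
qed

lemma SUP_eq_attained:
  fixes f :: "real \<Rightarrow> real"
  assumes "p \<in> S" "f p = v" "\<And>x. x \<in> S \<Longrightarrow> f x \<le> v"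
  shows "(SUP x\<in>S. f x) = v"
  by (rule cSup_eq_maximum) (use assms in auto)

theorem theorem7:
  fixes C :: real
  assumes "C \<ge> 0"
    and "C \<le> 3/4 \<or> C \<ge> 1 - p1 / 2"
  shows "diamond_capacity C C =
           (SUP p\<in>{0..1/2}. min (2*C) (min (C + h2 p) (min (h2 p + 1 - p) (C + h2 p - p/2))))
       \<and> diamond_capacity C C =
           (SUP p\<in>{0..1/2}. min (2*C - 1 + h2 p) (min (C + h2 p) (h2 p + 1 - p)))"
proof (cases "C \<le> 3/4")
  case True
  have cap: "diamond_capacity C C = 2 * C"
  proof (rule diamond_capacity_eqI[OF assms(1)])
    fix R :: real
    show "R \<le> 2 * C" if "diamond_achievable C C R" using achievable_le_sum[OF that] by simp
    assume R: "0 \<le> R" "R < 2 * C"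
    show "diamond_achievable C C R"
    proof (cases "C \<le> 1/2")
      case False
      \<comment> \<open>At \<open>p = 1/2\<close> the rate is
        \<open>1 + min (1/2) (2 * C - 1)\<close>, equal to \<open>2 * C\<close> because
        \<open>C \<le> 3/4\<close>.\<close>
      then show ?thesis
        using True R by (intro achievable_superposition[of C "1/2"]) (auto simp: h2_half)
    qed (use assms R achievable_low_capacity in auto)
  qed
  have "(SUP p\<in>{0..1/2}. min (2*C) (min (C + h2 p) (min (h2 p + 1 - p) (C + h2 p - p/2)))) = 2 * C"
    by (rule SUP_eq_attained[where p = "1/2"]) (use True in \<open>auto simp: h2_half\<close>)
  moreover have "(SUP p\<in>{0..1/2}. min (2*C - 1 + h2 p) (min (C + h2 p) (h2 p + 1 - p))) = 2 * C"
  proof (rule SUP_eq_attained[where p = "1/2"])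
    fix x :: real assume "x \<in> {0..1/2}"
    then show "min (2*C - 1 + h2 x) (min (C + h2 x) (h2 x + 1 - x)) \<le> 2 * C"
      using h2_le_1[of x] by (intro min.coboundedI1) simp
  qed (use True in \<open>auto simp: h2_half\<close>)
  ultimately show ?thesis using cap by simp
next
  case False
  then have C: "1 - p1 / 2 \<le> C" "3/4 < C" using assms by auto
  \<comment> \<open>\<open>1/3\<close> maximises \<open>h2 p + 1 - p\<close>, and
    \<open>2 - 2 * C\<close> is where this meets \<open>C + h2 p - p/2\<close>.\<close>
  define p where "p = max (1/3) (2 - 2 * C)"
  define V where "V = h2 p + 1 - p"
  have p: "1/3 \<le> p" "p \<le> 1/2" "2 - 2 * C \<le> p" and pC: "p = 1/3 \<or> p = 2 - 2 * C \<and> p \<le> p1"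
    using C p1_bounds by (auto simp: p_def max_def)
  \<comment> \<open>Together with \<open>1 - p \<le> 2 * C - 1\<close> this gives
    \<open>V \<le> 2 * C\<close>, so the term \<open>2 * C\<close> does not lower the first formula
    at \<open>p\<close>.\<close>
  have h2p: "h2 p \<le> 1" using p by (intro h2_le_1) auto
  have tangents: "min (x * - log 2 p + (1 - x) * (1 - log 2 (1 - p)))
      (C + x * (- log 2 p - 1/2) + (1 - x) * - log 2 (1 - p)) \<le> V" for x
    unfolding V_def by (rule min_tangents_le[OF p(1,2) pC])
  have cap: "diamond_capacity C C = V"
  proof (rule diamond_capacity_eqI[OF assms(1)])
    fix R :: real
    show "R \<le> V" if "diamond_achievable C C R"
      by (rule achievable_le_tangent_bound[OF that _ p(2) tangents]) (use p in simp)
    assume "0 \<le> R" "R < V"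
    \<comment> \<open>Since \<open>p \<ge> 2 - 2 * C\<close>, the minimum in the superposition rate
      is \<open>1 - p\<close>.\<close>
    then show "diamond_achievable C C R"
      using p C by (intro achievable_superposition[of C p]) (auto simp: V_def)
  qed
  \<comment> \<open>The curves lie below their tangents at \<open>p\<close>, so the affine estimate
    of the converse also bounds the single-letter formulas.\<close>
  have key: "min (h2 x + 1 - x) (C + h2 x - x/2) \<le> V" if x: "x \<in> {0..1/2}" for x
  proof -
    have "h2 x \<le> - x * log 2 p - (1 - x) * log 2 (1 - p)" using x p by (intro h2_le_cross) auto
    then have "min (h2 x + 1 - x) (C + h2 x - x/2)
        \<le> min (x * - log 2 p + (1 - x) * (1 - log 2 (1 - p)))
          (C + x * (- log 2 p - 1/2) + (1 - x) * - log 2 (1 - p))"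
      by (intro min.mono) (auto simp: algebra_simps)
    then show ?thesis using tangents[of x] by linarith
  qed
  have "(SUP p\<in>{0..1/2}. min (2*C) (min (C + h2 p) (min (h2 p + 1 - p) (C + h2 p - p/2)))) = V"
  proof (rule SUP_eq_attained[where p = p])
    fix x :: real assume "x \<in> {0..1/2}"
    then show "min (2*C) (min (C + h2 x) (min (h2 x + 1 - x) (C + h2 x - x/2))) \<le> V"
      using key[of x] by linarith
  qed (use p h2p in \<open>auto simp: V_def\<close>)
  moreover have "(SUP p\<in>{0..1/2}. min (2*C - 1 + h2 p) (min (C + h2 p) (h2 p + 1 - p))) = V"
  proof (rule SUP_eq_attained[where p = p])
    fix x :: real assume x: "x \<in> {0..1/2}"
    \<comment> \<open>\<open>C + h2 x - x/2\<close> is the mean of \<open>2*C - 1 + h2 x\<close> and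
      \<open>h2 x + 1 - x\<close>, hence at least their minimum.\<close>
    have "min (2*C - 1 + h2 x) (min (C + h2 x) (h2 x + 1 - x)) \<le> min (h2 x + 1 - x) (C + h2 x - x/2)"
      by (auto simp: min_def)
    then show "min (2*C - 1 + h2 x) (min (C + h2 x) (h2 x + 1 - x)) \<le> V" using key[OF x] by linarith
  qed (use p C in \<open>auto simp: V_def\<close>)
  ultimately show ?thesis using cap by simp
qed

end
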